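(* Let $\mu$ be a union of connected conjunctive queries over a finite relational signature $\tau$ and let $\sigma\subseteq\tau$. The resilience problem for $\mu$ where the relations from $\sigma$ are exogenous is polynomial-time equivalent to $\mathrm{VCSP}(\Gamma(\mathfrak{B},\sigma))$, for any dual $\mathfrak{B}$ of $\mu$; in particular, to $\mathrm{VCSP}(\Gamma_{\mu,\sigma})$.
   Context: **Queries.** A conjunctive query is a primitive positive $\tau$-sentence; a union of conjunctive queries is a finite disjunction of conjunctive queries. The canonical database of a conjunctive query is the $\tau$-structure on its variables whose tuples are the conjuncts of the query; the query is connected if this structure is not the disjoint union of two structures with non-empty domains. **Resilience.** A bag database over $\tau$ consists of a finite domain $A$ and for every $R\in\tau$ of arity $k$ a multiset of elements of $A^k$ (tuples are given with repetition); it satisfies $\mu$ if the structure obtained by forgetting multiplicities does. The resilience problem for $\mu$ with exogenous relations from $\sigma$: given a bag database $\mathfrak{A}$ and $u\in\mathbb{N}$, decide whether one can remove at most $u$ tuples (counted with multiplicity) from the relations $R^{\mathfrak{A}}$ with $R\in\tau\setminus\sigma$ so that the result does not satisfy $\mu$. **Duals.** A dual of $\mu$ is a (countable) $\tau$-structure $\mathfrak{B}$ such that a finite $\tau$-structure $\mathfrak{A}$ has a homomorphism to $\mathfrak{B}$ iff $\mathfrak{A}\not\models\mu$. **VCSP.** A valued $\tau$-structure $\Gamma$ on a countable domain $C$ assigns to each $R\in\tau$ of arity $k$ a function $R^\Gamma\colon C^k\to\mathbb{Q}\cup\{\infty\}$. A $\tau$-expression $\phi(x_1,\dots,x_n)$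 is a finite sum (repetitions allowed) of atomic expressions $R(x_{i_1},\dots,x_{i_k})$ with $R\in\tau\cup\{R_=,R_\emptyset\}$, where $R_=(x,y)=0$ if $x=y$ and $\infty$ otherwise, and $R_\emptyset(x)=\infty$ for all $x$; it defines $\phi^\Gamma\colon C^n\to\mathbb{Q}\cup\{\infty\}$. $\mathrm{VCSP}(\Gamma)$: given a $\tau$-expression $\phi$ and $u\in\mathbb{Q}$, decide whether some $a\in C^n$ satisfies $\phi^\Gamma(a)\le u$. **$\Gamma(\mathfrak{B},\sigma)$** is the valued $\tau$-structure on the domain of $\mathfrak{B}$ in which, for $a\in R^{\mathfrak{B}}$, $R(a)=0$, and for $a\notin R^{\mathfrak{B}}$, $R(a)=1$ if $R\in\tau\setminus\sigma$ and $R(a)=\infty$ if $R\in\sigma$. **$\Gamma_{\mu,\sigma}$** denotes $\Gamma(\mathfrak{B}_\mu,\sigma)$, where $\mathfrak{B}_\mu$ is the $\tau$-structure obtained from a theorem of Cherlin, Shelah and Shi. It has (among others) the following properties: it is countable, $\mathrm{Aut}(\mathfrak{B}_\mu)$ is oligomorphic (finitely many orbits of $k$-tuples for every $k$), a countable $\tau$-structure satisfies $\neg\mu$ iff it embeds into $\mathfrak{B}_\mu$ (so $\mathfrak{B}_\mu$ is a dual of $\mu$), and the expansion of $\mathfrak{B}_\mu$ by all relations definable by connected equality-free primitive positive formulas with at least one free variable and at most $|\mu|$ variables is homogeneous and finitely bounded, where $|\mu|$ is the maximum of $2$, the maximal arity of $\tau$ and the numbers of variables of the conjunctive queries in $\mu$.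 *)

theory Defs
  imports
    "HOL-Library.Multiset"
    "HOL-Library.Countable_Set"
    "HOL-Computational_Algebra.Polynomial"
begin

section \<open>Relational structures\<close>

text \<open>
  A relational signature is a set \<open>\<tau>\<close> of symbols together with an arity function \<open>ar\<close>; tuples are
  lists. The interpretation of symbols outside \<open>\<tau>\<close> is irrelevant. Domains may be empty.
\<close>

record ('r, 'a) struct =
  univ :: "'a set"
  interp :: "'r \<Rightarrow> 'a list set"

definition tuples_over :: "nat \<Rightarrow> 'a set \<Rightarrow> 'a list set" where
  "tuples_over k A = {xs. length xs = k \<and> set xs \<subseteq> A}"

definition is_struct :: "'r set \<Rightarrow> ('r \<Rightarrow> nat) \<Rightarrow> ('r, 'a) struct \<Rightarrow> bool" where
  "is_struct \<tau> ar A \<longleftrightarrow> (\<forall>R\<in>\<tau>. interp A R \<subseteq> tuples_over (ar R) (univ A))"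

definition is_hom ::
  "'r set \<Rightarrow> ('a \<Rightarrow> 'b) \<Rightarrow> ('r, 'a) struct \<Rightarrow> ('r, 'b) struct \<Rightarrow> bool" where
  "is_hom \<tau> h A B \<longleftrightarrow>
     h ` univ A \<subseteq> univ B \<and> (\<forall>R\<in>\<tau>. \<forall>xs\<in>interp A R. map h xs \<in> interp B R)"

definition is_embedding ::
  "'r set \<Rightarrow> ('r \<Rightarrow> nat) \<Rightarrow> ('a \<Rightarrow> 'b) \<Rightarrow> ('r, 'a) struct \<Rightarrow> ('r, 'b) struct \<Rightarrow> bool" where
  "is_embedding \<tau> ar h A B \<longleftrightarrow>
     h ` univ A \<subseteq> univ B \<and> inj_on h (univ A) \<and>
     (\<forall>R\<in>\<tau>. \<forall>xs\<in>tuples_over (ar R) (univ A). xs \<in> interp A R \<longleftrightarrow> map h xs \<in> interp B R)"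

definition embeds ::
  "'r set \<Rightarrow> ('r \<Rightarrow> nat) \<Rightarrow> ('r, 'a) struct \<Rightarrow> ('r, 'b) struct \<Rightarrow> bool" where
  "embeds \<tau> ar A B \<longleftrightarrow> (\<exists>h. is_embedding \<tau> ar h A B)"

definition Aut :: "'r set \<Rightarrow> ('r \<Rightarrow> nat) \<Rightarrow> ('r, 'a) struct \<Rightarrow> ('a \<Rightarrow> 'a) set" where
  "Aut \<tau> ar A = {g. is_embedding \<tau> ar g A A \<and> g ` univ A = univ A}"

definition oligomorphic :: "'r set \<Rightarrow> ('r \<Rightarrow> nat) \<Rightarrow> ('r, 'a) struct \<Rightarrow> bool" where
  "oligomorphic \<tau> ar A \<longleftrightarrow>
     (\<forall>k. finite ((\<lambda>xs. {map g xs | g. g \<in> Aut \<tau> ar A}) ` tuples_over k (univ A)))"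

text \<open>Homogeneity: isomorphisms between finite substructures extend to automorphisms.\<close>

definition homogeneous :: "'r set \<Rightarrow> ('r \<Rightarrow> nat) \<Rightarrow> ('r, 'a) struct \<Rightarrow> bool" where
  "homogeneous \<tau> ar A \<longleftrightarrow>
     (\<forall>F h. finite F \<and> F \<subseteq> univ A \<and>
            is_embedding \<tau> ar h \<lparr>univ = F, interp = (\<lambda>R. interp A R \<inter> tuples_over (ar R) F)\<rparr> A \<longrightarrow>
            (\<exists>g\<in>Aut \<tau> ar A. \<forall>x\<in>F. g x = h x))"

text \<open>
  Every countable structure is isomorphic to one whose domain is a set of natural numbers, so
  quantification over all finite (or all countable) structures is quantification over structures
  with elements of type \<^typ>\<open>nat\<close>.
\<close>

definition finitely_bounded :: "'r set \<Rightarrow> ('r \<Rightarrow> nat) \<Rightarrow> ('r, 'a) struct \<Rightarrow> bool" where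
  "finitely_bounded \<tau> ar B \<longleftrightarrow>
     finite \<tau> \<and>
     (\<exists>N :: ('r, nat) struct list.
        (\<forall>F\<in>set N. is_struct \<tau> ar F \<and> finite (univ F)) \<and>
        (\<forall>A :: ('r, nat) struct. is_struct \<tau> ar A \<and> finite (univ A) \<longrightarrow>
           (embeds \<tau> ar A B \<longleftrightarrow> (\<forall>F\<in>set N. \<not> embeds \<tau> ar F A))))"

text \<open>Only structures with disjoint domains are combined.\<close>

definition is_disjoint_union ::
  "'r set \<Rightarrow> ('r, 'a) struct \<Rightarrow> ('r, 'a) struct \<Rightarrow> ('r, 'a) struct \<Rightarrow> bool" where
  "is_disjoint_union \<tau> A A1 A2 \<longleftrightarrow>
     univ A1 \<inter> univ A2 = {} \<and> univ A = univ A1 \<union> univ A2 \<and>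
     (\<forall>R\<in>\<tau>. interp A R = interp A1 R \<union> interp A2 R)"

definition connected_struct :: "'r set \<Rightarrow> ('r \<Rightarrow> nat) \<Rightarrow> ('r, 'a) struct \<Rightarrow> bool" where
  "connected_struct \<tau> ar A \<longleftrightarrow>
     \<not> (\<exists>A1 A2. is_struct \<tau> ar A1 \<and> is_struct \<tau> ar A2 \<and> univ A1 \<noteq> {} \<and> univ A2 \<noteq> {} \<and>
           is_disjoint_union \<tau> A A1 A2)"


section \<open>Conjunctive queries and duals\<close>

text \<open>
  An equality-free primitive positive formula is given by its finite set of variables and its
  finite set of conjuncts \<open>R(x\<^sub>1,\<dots>,x\<^sub>k)\<close>. As a conjunctive query, all its variables are existentially
  quantified; variables need not occur in a conjunct. A union of conjunctive queries is a
  non-empty list of conjunctive queries.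
\<close>

record 'r cq =
  vars :: "nat set"
  conjuncts :: "('r \<times> nat list) set"

definition is_cq :: "'r set \<Rightarrow> ('r \<Rightarrow> nat) \<Rightarrow> 'r cq \<Rightarrow> bool" where
  "is_cq \<tau> ar q \<longleftrightarrow>
     finite (vars q) \<and> finite (conjuncts q) \<and>
     (\<forall>(R, xs)\<in>conjuncts q. R \<in> \<tau> \<and> xs \<in> tuples_over (ar R) (vars q))"

definition is_ucq :: "'r set \<Rightarrow> ('r \<Rightarrow> nat) \<Rightarrow> 'r cq list \<Rightarrow> bool" where
  "is_ucq \<tau> ar \<mu> \<longleftrightarrow> \<mu> \<noteq> [] \<and> (\<forall>q\<in>set \<mu>. is_cq \<tau> ar q)"

definition canonical_db :: "'r cq \<Rightarrow> ('r, nat) struct" where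
  "canonical_db q = \<lparr>univ = vars q, interp = (\<lambda>R. {xs. (R, xs) \<in> conjuncts q})\<rparr>"

definition connected_cq :: "'r set \<Rightarrow> ('r \<Rightarrow> nat) \<Rightarrow> 'r cq \<Rightarrow> bool" where
  "connected_cq \<tau> ar q \<longleftrightarrow> connected_struct \<tau> ar (canonical_db q)"

definition cq_assignment :: "'r cq \<Rightarrow> ('r, 'a) struct \<Rightarrow> (nat \<Rightarrow> 'a) \<Rightarrow> bool" where
  "cq_assignment q A h \<longleftrightarrow>
     (\<forall>x\<in>vars q. h x \<in> univ A) \<and> (\<forall>(R, xs)\<in>conjuncts q. map h xs \<in> interp A R)"

definition models_ucq :: "('r, 'a) struct \<Rightarrow> 'r cq list \<Rightarrow> bool" where
  "models_ucq A \<mu> \<longleftrightarrow> (\<exists>q\<in>set \<mu>. \<exists>h. cq_assignment q A h)"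

definition is_dual ::
  "'r set \<Rightarrow> ('r \<Rightarrow> nat) \<Rightarrow> 'r cq list \<Rightarrow> ('r, 'b) struct \<Rightarrow> bool" where
  "is_dual \<tau> ar \<mu> B \<longleftrightarrow>
     is_struct \<tau> ar B \<and> countable (univ B) \<and>
     (\<forall>A :: ('r, nat) struct. is_struct \<tau> ar A \<and> finite (univ A) \<longrightarrow>
        ((\<exists>h. is_hom \<tau> h A B) \<longleftrightarrow> \<not> models_ucq A \<mu>))"


section \<open>The structure of Cherlin, Shelah and Shi\<close>

definition ucq_size :: "'r set \<Rightarrow> ('r \<Rightarrow> nat) \<Rightarrow> 'r cq list \<Rightarrow> nat" where
  "ucq_size \<tau> ar \<mu> = Max ({2} \<union> ar ` \<tau> \<union> (\<lambda>q. card (vars q)) ` set \<mu>)"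

text \<open>
  The relations, with their arities, that are definable in \<open>B\<close> by connected equality-free primitive
  positive formulas with a non-empty list \<open>ys\<close> of free variables and at most \<open>m\<close> variables
  altogether; the variables not in \<open>ys\<close> are existentially quantified.
\<close>

definition connected_pp_relations ::
  "'r set \<Rightarrow> ('r \<Rightarrow> nat) \<Rightarrow> nat \<Rightarrow> ('r, 'b) struct \<Rightarrow> (nat \<times> 'b list set) set" where
  "connected_pp_relations \<tau> ar m B =
     {(length ys, {map h ys | h. cq_assignment q B h}) | q ys.
        is_cq \<tau> ar q \<and> connected_cq \<tau> ar q \<and> card (vars q) \<le> m \<and>
        ys \<noteq> [] \<and> distinct ys \<and> set ys \<subseteq> vars q}"

text \<open>
  The signature, arities and structure of the expansion of \<open>B\<close> by a set of relations, each of which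
  serves as a new symbol denoting itself.
\<close>

definition exp_sig :: "'r set \<Rightarrow> (nat \<times> 'b list set) set \<Rightarrow> ('r + nat \<times> 'b list set) set" where
  "exp_sig \<tau> \<R> = Inl ` \<tau> \<union> Inr ` \<R>"

definition exp_ar :: "('r \<Rightarrow> nat) \<Rightarrow> 'r + nat \<times> 'b list set \<Rightarrow> nat" where
  "exp_ar ar = case_sum ar fst"

definition expansion :: "('r, 'b) struct \<Rightarrow> ('r + nat \<times> 'b list set, 'b) struct" where
  "expansion B = \<lparr>univ = univ B, interp = case_sum (interp B) snd\<rparr>"

definition is_CSS_structure ::
  "'r set \<Rightarrow> ('r \<Rightarrow> nat) \<Rightarrow> 'r cq list \<Rightarrow> ('r, 'b) struct \<Rightarrow> bool" where
  "is_CSS_structure \<tau> ar \<mu> B \<longleftrightarrow>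
     is_struct \<tau> ar B \<and> countable (univ B) \<and> oligomorphic \<tau> ar B \<and>
     (\<forall>A :: ('r, nat) struct. is_struct \<tau> ar A \<longrightarrow>
        (\<not> models_ucq A \<mu> \<longleftrightarrow> embeds \<tau> ar A B)) \<and>
     (let \<R> = connected_pp_relations \<tau> ar (ucq_size \<tau> ar \<mu>) B in
        homogeneous (exp_sig \<tau> \<R>) (exp_ar ar) (expansion B) \<and>
        finitely_bounded (exp_sig \<tau> \<R>) (exp_ar ar) (expansion B))"


section \<open>Polynomial-time reductions\<close>

text \<open>
  Computations are those of WHILE programs over binary trees (as in N. D. Jones, Computability and
  Complexity from a Programming Perspective). In contrast to a unit-cost semantics, every
  evaluation of an expression is charged the sizes of the values of all its subexpressions,
  so that values of size \<open>n\<close> cost at least \<open>n\<close> to produce and copying is not free. With this cost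
  measure the functions computable in polynomial time are those of polynomial-time Turing machines.
\<close>

datatype data = NIL | CONS data data

primrec dsize :: "data \<Rightarrow> nat" where
  "dsize NIL = 1"
| "dsize (CONS a b) = dsize a + dsize b + 1"

datatype expr = Var nat | ENil | ECons expr expr | Hd expr | Tl expr | Eq expr expr

datatype com = Skip | Assign nat expr | Seq com com | If expr com com | While expr com

fun dhd :: "data \<Rightarrow> data" where
  "dhd NIL = NIL"
| "dhd (CONS a b) = a"

fun dtl :: "data \<Rightarrow> data" where
  "dtl NIL = NIL"
| "dtl (CONS a b) = b"

type_synonym store = "nat \<Rightarrow> data"

primrec eval_expr :: "expr \<Rightarrow> store \<Rightarrow> data" where
  "eval_expr (Var x) s = s x"
| "eval_expr ENil s = NIL"
| "eval_expr (ECons e f) s = CONS (eval_expr e s) (eval_expr f s)"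
| "eval_expr (Hd e) s = dhd (eval_expr e s)"
| "eval_expr (Tl e) s = dtl (eval_expr e s)"
| "eval_expr (Eq e f) s = (if eval_expr e s = eval_expr f s then CONS NIL NIL else NIL)"

primrec expr_cost :: "expr \<Rightarrow> store \<Rightarrow> nat" where
  "expr_cost (Var x) s = dsize (s x)"
| "expr_cost ENil s = 1"
| "expr_cost (ECons e f) s = expr_cost e s + expr_cost f s + dsize (eval_expr (ECons e f) s)"
| "expr_cost (Hd e) s = expr_cost e s + dsize (eval_expr (Hd e) s)"
| "expr_cost (Tl e) s = expr_cost e s + dsize (eval_expr (Tl e) s)"
| "expr_cost (Eq e f) s = expr_cost e s + expr_cost f s + dsize (eval_expr (Eq e f) s)"

text \<open>\<open>run c s t s'\<close>: started in \<open>s\<close>, the program \<open>c\<close> halts in \<open>s'\<close> after time \<open>t\<close>.\<close>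

inductive run :: "com \<Rightarrow> store \<Rightarrow> nat \<Rightarrow> store \<Rightarrow> bool" where
  run_Skip: "run Skip s 1 s"
| run_Assign: "run (Assign x e) s (expr_cost e s + 1) (s(x := eval_expr e s))"
| run_Seq: "run c1 s t1 s1 \<Longrightarrow> run c2 s1 t2 s2 \<Longrightarrow> run (Seq c1 c2) s (t1 + t2 + 1) s2"
| run_IfTrue: "eval_expr e s \<noteq> NIL \<Longrightarrow> run c1 s t s' \<Longrightarrow>
    run (If e c1 c2) s (expr_cost e s + t + 1) s'"
| run_IfFalse: "eval_expr e s = NIL \<Longrightarrow> run c2 s t s' \<Longrightarrow>
    run (If e c1 c2) s (expr_cost e s + t + 1) s'"
| run_WhileFalse: "eval_expr e s = NIL \<Longrightarrow> run (While e c) s (expr_cost e s + 1) s"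
| run_WhileTrue: "eval_expr e s \<noteq> NIL \<Longrightarrow> run c s t1 s1 \<Longrightarrow> run (While e c) s1 t2 s2 \<Longrightarrow>
    run (While e c) s (expr_cost e s + t1 + t2 + 1) s2"

text \<open>Input and output are held in variable 0; all other variables are initially \<^const>\<open>NIL\<close>.\<close>

definition polytime_computable_on :: "data set \<Rightarrow> (data \<Rightarrow> data) \<Rightarrow> bool" where
  "polytime_computable_on I f \<longleftrightarrow>
     (\<exists>c (p :: nat poly). \<forall>x\<in>I. \<exists>t s.
        run c ((\<lambda>_. NIL)(0 := x)) t s \<and> s 0 = f x \<and> t \<le> poly p (dsize x))"

text \<open>
  A decision problem: its instances, those instances whose answer is yes, and the encoding of
  instances as input data.
\<close>

record 'i problem =
  instances :: "'i set"
  yes_instances :: "'i set"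
  encoding :: "'i \<Rightarrow> data"

text \<open>Polynomial-time many-one reducibility.\<close>

definition polytime_reducible :: "'i problem \<Rightarrow> 'j problem \<Rightarrow> bool" where
  "polytime_reducible P Q \<longleftrightarrow>
     (\<exists>f g. polytime_computable_on (encoding P ` instances P) g \<and>
        (\<forall>x\<in>instances P. f x \<in> instances Q \<and> g (encoding P x) = encoding Q (f x) \<and>
           (x \<in> yes_instances P \<longleftrightarrow> f x \<in> yes_instances Q)))"

definition polytime_equivalent :: "'i problem \<Rightarrow> 'j problem \<Rightarrow> bool" where
  "polytime_equivalent P Q \<longleftrightarrow> polytime_reducible P Q \<and> polytime_reducible Q P"

text \<open>Numbers are encoded in binary, least significant bit first.\<close>

definition enc_bool :: "bool \<Rightarrow> data" where
  "enc_bool b = (if b then CONS NIL NIL else NIL)"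

fun enc_nat :: "nat \<Rightarrow> data" where
  "enc_nat n = (if n = 0 then NIL else CONS (enc_bool (odd n)) (enc_nat (n div 2)))"

declare enc_nat.simps [simp del]

definition enc_int :: "int \<Rightarrow> data" where
  "enc_int i = CONS (enc_bool (i < 0)) (enc_nat (nat \<bar>i\<bar>))"

definition enc_rat :: "rat \<Rightarrow> data" where
  "enc_rat u = CONS (enc_int (fst (quotient_of u))) (enc_nat (nat (snd (quotient_of u))))"

primrec enc_list :: "('a \<Rightarrow> data) \<Rightarrow> 'a list \<Rightarrow> data" where
  "enc_list f [] = NIL"
| "enc_list f (x # xs) = CONS (f x) (enc_list f xs)"


section \<open>Resilience\<close>

record ('r, 'a) bagdb =
  bag_univ :: "'a set"
  bag_interp :: "'r \<Rightarrow> 'a list multiset"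

definition struct_of_bagdb :: "('r, 'a) bagdb \<Rightarrow> ('r, 'a) struct" where
  "struct_of_bagdb \<AA> = \<lparr>univ = bag_univ \<AA>, interp = (\<lambda>R. set_mset (bag_interp \<AA> R))\<rparr>"

definition is_bagdb :: "'r set \<Rightarrow> ('r \<Rightarrow> nat) \<Rightarrow> ('r, 'a) bagdb \<Rightarrow> bool" where
  "is_bagdb \<tau> ar \<AA> \<longleftrightarrow> finite (bag_univ \<AA>) \<and> is_struct \<tau> ar (struct_of_bagdb \<AA>)"

definition remove_tuples ::
  "('r, 'a) bagdb \<Rightarrow> ('r \<Rightarrow> 'a list multiset) \<Rightarrow> ('r, 'a) bagdb" where
  "remove_tuples \<AA> D = \<AA>\<lparr>bag_interp := (\<lambda>R. bag_interp \<AA> R - D R)\<rparr>"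

text \<open>\<open>D\<close> collects the removed tuples.\<close>

definition resilience_le ::
  "'r set \<Rightarrow> 'r set \<Rightarrow> 'r cq list \<Rightarrow> ('r, 'a) bagdb \<Rightarrow> nat \<Rightarrow> bool" where
  "resilience_le \<tau> \<sigma> \<mu> \<AA> u \<longleftrightarrow>
     (\<exists>D. (\<forall>R\<in>\<tau> - \<sigma>. D R \<subseteq># bag_interp \<AA> R) \<and> (\<forall>R. R \<notin> \<tau> - \<sigma> \<longrightarrow> D R = {#}) \<and>
          (\<Sum>R\<in>\<tau> - \<sigma>. size (D R)) \<le> u \<and>
          \<not> models_ucq (struct_of_bagdb (remove_tuples \<AA> D)) \<mu>)"

text \<open>
  An instance of the resilience problem lists the domain of a bag database, its tuples with
  repetitions (each together with its relation symbol), and the bound.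
\<close>

type_synonym resilience_inst = "nat list \<times> (nat \<times> nat list) list \<times> nat"

definition bagdb_of :: "nat list \<Rightarrow> (nat \<times> nat list) list \<Rightarrow> (nat, nat) bagdb" where
  "bagdb_of ds ts =
     \<lparr>bag_univ = set ds, bag_interp = (\<lambda>R. mset (map snd (filter (\<lambda>t. fst t = R) ts)))\<rparr>"

definition enc_resilience :: "resilience_inst \<Rightarrow> data" where
  "enc_resilience = (\<lambda>(ds, ts, u).
     CONS (enc_list enc_nat ds)
       (CONS (enc_list (\<lambda>(R, xs). CONS (enc_nat R) (enc_list enc_nat xs)) ts) (enc_nat u)))"

definition resilience_problem ::
  "nat set \<Rightarrow> (nat \<Rightarrow> nat) \<Rightarrow> nat set \<Rightarrow> nat cq list \<Rightarrow> resilience_inst problem" where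
  "resilience_problem \<tau> ar \<sigma> \<mu> =
     (let I = {(ds, ts, u). distinct ds \<and> fst ` set ts \<subseteq> \<tau> \<and> is_bagdb \<tau> ar (bagdb_of ds ts)} in
      \<lparr>instances = I,
       yes_instances = {(ds, ts, u) \<in> I. resilience_le \<tau> \<sigma> \<mu> (bagdb_of ds ts) u},
       encoding = enc_resilience\<rparr>)"


section \<open>Valued constraint satisfaction\<close>

datatype cost = Fin rat | Infty

instantiation cost :: "{linorder, comm_monoid_add}"
begin

definition zero_cost :: cost where "0 = Fin 0"

fun plus_cost :: "cost \<Rightarrow> cost \<Rightarrow> cost" where
  "Fin a + Fin b = Fin (a + b)"
| "Infty + _ = Infty"
| "_ + Infty = Infty"

fun less_eq_cost :: "cost \<Rightarrow> cost \<Rightarrow> bool" where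
  "Fin a \<le> Fin b \<longleftrightarrow> a \<le> b"
| "_ \<le> Infty \<longleftrightarrow> True"
| "Infty \<le> Fin _ \<longleftrightarrow> False"

definition less_cost :: "cost \<Rightarrow> cost \<Rightarrow> bool" where
  "a < b \<longleftrightarrow> a \<le> b \<and> \<not> b \<le> (a :: cost)"

instance
proof
  fix a b c :: cost
  show "a < b \<longleftrightarrow> a \<le> b \<and> \<not> b \<le> a" by (rule less_cost_def)
  show "a \<le> a" by (cases a) auto
  show "a \<le> b \<Longrightarrow> b \<le> c \<Longrightarrow> a \<le> c" by (cases a; cases b; cases c) auto
  show "a \<le> b \<Longrightarrow> b \<le> a \<Longrightarrow> a = b" by (cases a; cases b) auto
  show "a \<le> b \<or> b \<le> a" by (cases a; cases b) auto
  show "a + b + c = a + (b + c)" by (cases a; cases b; cases c) auto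
  show "a + b = b + a" by (cases a; cases b) auto
  show "0 + a = a" by (cases a) (auto simp: zero_cost_def)
qed

end

record ('r, 'c) valued_struct =
  val_univ :: "'c set"
  val_interp :: "'r \<Rightarrow> 'c list \<Rightarrow> cost"

text \<open>Atomic expressions over \<open>\<tau>\<close> and the two additional symbols \<open>R\<^sub>=\<close> and \<open>R\<^sub>\<emptyset>\<close>.\<close>

datatype 'r atom = Rel 'r "nat list" | REq nat nat | REmpty nat

fun is_atom :: "'r set \<Rightarrow> ('r \<Rightarrow> nat) \<Rightarrow> nat set \<Rightarrow> 'r atom \<Rightarrow> bool" where
  "is_atom \<tau> ar X (Rel R xs) \<longleftrightarrow> R \<in> \<tau> \<and> xs \<in> tuples_over (ar R) X"
| "is_atom \<tau> ar X (REq x y) \<longleftrightarrow> x \<in> X \<and> y \<in> X"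
| "is_atom \<tau> ar X (REmpty x) \<longleftrightarrow> x \<in> X"

fun atom_cost :: "('r, 'c) valued_struct \<Rightarrow> (nat \<Rightarrow> 'c) \<Rightarrow> 'r atom \<Rightarrow> cost" where
  "atom_cost \<Gamma> a (Rel R xs) = val_interp \<Gamma> R (map a xs)"
| "atom_cost \<Gamma> a (REq x y) = (if a x = a y then 0 else Infty)"
| "atom_cost \<Gamma> a (REmpty x) = Infty"

definition expression_cost :: "('r, 'c) valued_struct \<Rightarrow> 'r atom list \<Rightarrow> (nat \<Rightarrow> 'c) \<Rightarrow> cost" where
  "expression_cost \<Gamma> \<phi> a = (\<Sum>\<alpha>\<leftarrow>\<phi>. atom_cost \<Gamma> a \<alpha>)"

text \<open>
  An instance \<open>(xs, \<phi>, u)\<close> consists of the list of the distinct variables of the expression, the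
  summands of the expression, and the threshold. A tuple in \<open>C\<^sup>n\<close> is represented by the assignment
  of its entries to these variables.
\<close>

type_synonym vcsp_inst = "nat list \<times> nat atom list \<times> rat"

fun enc_atom :: "nat atom \<Rightarrow> data" where
  "enc_atom (Rel R xs) = CONS (enc_nat 0) (CONS (enc_nat R) (enc_list enc_nat xs))"
| "enc_atom (REq x y) = CONS (enc_nat 1) (CONS (enc_nat x) (enc_nat y))"
| "enc_atom (REmpty x) = CONS (enc_nat 2) (enc_nat x)"

definition enc_vcsp :: "vcsp_inst \<Rightarrow> data" where
  "enc_vcsp = (\<lambda>(xs, \<phi>, u).
     CONS (enc_list enc_nat xs) (CONS (enc_list enc_atom \<phi>) (enc_rat u)))"

definition VCSP ::
  "nat set \<Rightarrow> (nat \<Rightarrow> nat) \<Rightarrow> (nat, 'c) valued_struct \<Rightarrow> vcsp_inst problem" where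
  "VCSP \<tau> ar \<Gamma> =
     (let I = {(xs, \<phi>, u). distinct xs \<and> (\<forall>\<alpha>\<in>set \<phi>. is_atom \<tau> ar (set xs) \<alpha>)} in
      \<lparr>instances = I,
       yes_instances = {(xs, \<phi>, u) \<in> I.
         \<exists>a. (\<forall>x\<in>set xs. a x \<in> val_univ \<Gamma>) \<and> expression_cost \<Gamma> \<phi> a \<le> Fin u},
       encoding = enc_vcsp\<rparr>)"

definition Gamma :: "('r, 'b) struct \<Rightarrow> 'r set \<Rightarrow> ('r, 'b) valued_struct" where
  "Gamma B \<sigma> =
     \<lparr>val_univ = univ B,
      val_interp = (\<lambda>R xs. if xs \<in> interp B R then 0 else if R \<in> \<sigma> then Infty else Fin 1)\<rparr>"


section \<open>Injectivity of the encodings\<close>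

lemma inj_enc_nat: "inj enc_nat"
proof (rule injI)
  fix m n show "enc_nat m = enc_nat n \<Longrightarrow> m = n"
  proof (induction m arbitrary: n rule: less_induct)
    case (less m)
    show ?case
    proof (cases "m = 0 \<or> n = 0")
      case True
      with less.prems show ?thesis
        by (auto simp: enc_nat.simps[of m] enc_nat.simps[of n] split: if_splits)
    next
      case False
      with less.prems have "odd m = odd n" "enc_nat (m div 2) = enc_nat (n div 2)"
        by (auto simp: enc_nat.simps[of m] enc_nat.simps[of n] enc_bool_def split: if_splits)
      moreover from this(2) less.IH[of "m div 2"] False have "m div 2 = n div 2" by simp
      ultimately show ?thesis by (metis even_two_times_div_two odd_two_times_div_two_succ)
    qed
  qed
qed

lemma enc_nat_eq_iff [simp]: "enc_nat m = enc_nat n \<longleftrightarrow> m = n"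
  using inj_enc_nat by (auto dest: injD)

lemma enc_list_eq_iff:
  "inj f \<Longrightarrow> enc_list f xs = enc_list f ys \<longleftrightarrow> xs = ys"
proof (induction xs arbitrary: ys)
  case Nil then show ?case by (cases ys) auto
next
  case (Cons x xs) then show ?case by (cases ys) (auto dest: injD)
qed

lemma inj_enc_rat: "inj enc_rat"
proof (rule injI)
  fix u v assume eq: "enc_rat u = enc_rat v"
  have "snd (quotient_of u) > 0" "snd (quotient_of v) > 0" by (simp_all add: quotient_of_denom_pos')
  with eq have "quotient_of u = quotient_of v"
    by (auto simp: enc_rat_def enc_int_def enc_bool_def prod_eq_iff split: if_splits)
  then show "u = v" by (rule quotient_of_inject)
qed

lemma inj_enc_atom: "inj enc_atom"
proof (rule injI)
  fix \<alpha> \<beta> show "enc_atom \<alpha> = enc_atom \<beta> \<Longrightarrow> \<alpha> = \<beta>"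
    by (cases \<alpha>; cases \<beta>) (auto simp: enc_list_eq_iff[OF inj_enc_nat])
qed

lemma inj_enc_resilience: "inj enc_resilience"
proof -
  have "inj (\<lambda>(R, xs). CONS (enc_nat R) (enc_list enc_nat xs))"
    by (auto intro!: injI simp: enc_list_eq_iff[OF inj_enc_nat])
  then show ?thesis
    by (auto intro!: injI simp: enc_resilience_def enc_list_eq_iff[OF inj_enc_nat] enc_list_eq_iff)
qed

lemma inj_enc_vcsp: "inj enc_vcsp"
  using inj_enc_rat
  by (auto intro!: injI dest: injD
      simp: enc_vcsp_def enc_list_eq_iff[OF inj_enc_nat] enc_list_eq_iff[OF inj_enc_atom])

end

theory Submission
  imports Defs
begin

text \<open>
  A database is read as the sum of its tuples and vice versa. An assignment of the domain into a
  dual \<open>B\<close> becomes a homomorphism after deletion of exactly those tuples that it violates, so the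
  resilience is the minimal cost of an assignment. In the direction from VCSP, equality constraints
  are eliminated by identifying variables, \<open>R\<^sub>\<emptyset>\<close> and negative thresholds lead to a fixed
  no-instance, and the threshold \<open>u\<close> is replaced by \<open>\<lfloor>u\<rfloor>\<close>, computed by long division of binary numbers.
  That these transformations run in polynomial time follows from closure properties of the
  polynomial-time computable functions, above all closure under folds over lists whose intermediate
  results have polynomially bounded size.
\<close>

section \<open>Closure properties of polynomial-time computability\<close>

text \<open>Time bounds are proved for all trees, not only for encodings. Each reduction is
  therefore a total function on \<open>data\<close>: every tree is read as a list along its right
  spine, \<open>dhd NIL\<close> and \<open>dtl NIL\<close> act as defaults, and separate lemmas show
  that encodings are treated correctly. The obstacle is size, because iterating a cheap step can
  double the accumulator again and again. Two folds resist a simple bound on growth per step: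
  solving equations, where everything stored is a piece of the input, and division, where the number
  of bits has to be counted instead of the size. Variables are identified because a database has no
  equality relation, while a violated equation costs infinitely much. Rounding the threshold is
  harmless because a finite cost counts violated tuples; repeated summands become multiplicities.
  For the structure of Cherlin, Shelah and Shi, the gap to close is between embeddings, of which its
  defining property speaks, and homomorphisms.\<close>

definition poly_bounded :: "(nat \<Rightarrow> nat) \<Rightarrow> bool" where
  "poly_bounded b \<longleftrightarrow> (\<exists>p. \<forall>n. b n \<le> poly p n)"

lemma poly_nat_mono: "m \<le> n \<Longrightarrow> poly p m \<le> poly p n" for m n :: nat
  by (induction p) (auto intro: add_mono mult_mono)

lemma poly_bounded_const: "poly_bounded (\<lambda>n. k)"
  unfolding poly_bounded_def by (rule exI[of _ "[:k:]"]) simp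

lemma poly_bounded_id: "poly_bounded (\<lambda>n. n)"
  unfolding poly_bounded_def by (rule exI[of _ "[:0, 1:]"]) simp

lemma poly_bounded_add: "poly_bounded a \<Longrightarrow> poly_bounded b \<Longrightarrow> poly_bounded (\<lambda>n. a n + b n)"
  unfolding poly_bounded_def by (metis add_mono poly_add)

lemma poly_bounded_mult: "poly_bounded a \<Longrightarrow> poly_bounded b \<Longrightarrow> poly_bounded (\<lambda>n. a n * b n)"
  unfolding poly_bounded_def by (metis mult_le_mono poly_mult)

lemma poly_bounded_poly: "poly_bounded b \<Longrightarrow> poly_bounded (\<lambda>n. poly p (b n))"
  unfolding poly_bounded_def by (metis poly_nat_mono poly_pcompose)

lemmas poly_bounded_intros =
  poly_bounded_const poly_bounded_id poly_bounded_add poly_bounded_mult poly_bounded_poly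

lemma dsize_pos: "0 < dsize x"
  by (cases x) auto

lemma dsize_dhd: "dsize (dhd x) \<le> dsize x" and dsize_dtl: "dsize (dtl x) \<le> dsize x"
  by (cases x; simp)+

lemma dsize_eval_expr: "dsize (eval_expr e s) \<le> expr_cost e s"
  by (cases e) auto

text \<open>Every assignment is charged at least the size of the value it stores. This turns time
  bounds into bounds on the output size.\<close>

lemma run_dsize: "run c s t s' \<Longrightarrow> dsize (s' v) \<le> dsize (s v) + t"
  by (induction rule: run.induct) (auto simp: trans_le_add2 le_SucI dsize_eval_expr)

definition run_within :: "com \<Rightarrow> store \<Rightarrow> nat \<Rightarrow> store \<Rightarrow> bool" where
  "run_within c s b s' \<longleftrightarrow> (\<exists>t\<le>b. run c s t s')"

lemma run_within_run: "run c s t s' \<Longrightarrow> t \<le> b \<Longrightarrow> run_within c s b s'"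
  unfolding run_within_def by blast

lemma run_within_mono: "run_within c s b s' \<Longrightarrow> b \<le> b' \<Longrightarrow> run_within c s b' s'"
  unfolding run_within_def by (meson order_trans)

lemma run_within_Assign:
  "eval_expr e s = v \<Longrightarrow> s(x := v) = s' \<Longrightarrow> expr_cost e s + 1 \<le> b \<Longrightarrow> run_within (Assign x e) s b s'"
  unfolding run_within_def using run_Assign by blast

lemma run_within_Seq:
  "run_within c1 s b1 s1 \<Longrightarrow> run_within c2 s1 b2 s2 \<Longrightarrow> run_within (Seq c1 c2) s (b1 + b2 + 1) s2"
  unfolding run_within_def by (meson add_mono le_refl run_Seq)

lemma run_within_If:
  assumes "run_within (if eval_expr e s = NIL then c2 else c1) s b s'"
  shows "run_within (If e c1 c2) s (expr_cost e s + b + 1) s'"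
proof -
  obtain t where t: "t \<le> b" "run (if eval_expr e s = NIL then c2 else c1) s t s'"
    using assms unfolding run_within_def by blast
  then have "run (If e c1 c2) s (expr_cost e s + t + 1) s'"
    by (cases "eval_expr e s = NIL") (simp_all only: run_IfTrue run_IfFalse if_True if_False simp_thms)
  with t(1) show ?thesis
    unfolding run_within_def by (intro exI[of _ "expr_cost e s + t + 1"]) simp
qed

section \<open>Relocating programs to higher variables\<close>

primrec shift_expr :: "nat \<Rightarrow> expr \<Rightarrow> expr" where
  "shift_expr k (Var x) = Var (x + k)"
| "shift_expr k ENil = ENil"
| "shift_expr k (ECons e f) = ECons (shift_expr k e) (shift_expr k f)"
| "shift_expr k (Hd e) = Hd (shift_expr k e)"
| "shift_expr k (Tl e) = Tl (shift_expr k e)"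
| "shift_expr k (Eq e f) = Eq (shift_expr k e) (shift_expr k f)"

primrec shift_com :: "nat \<Rightarrow> com \<Rightarrow> com" where
  "shift_com k Skip = Skip"
| "shift_com k (Assign x e) = Assign (x + k) (shift_expr k e)"
| "shift_com k (Seq c d) = Seq (shift_com k c) (shift_com k d)"
| "shift_com k (If e c d) = If (shift_expr k e) (shift_com k c) (shift_com k d)"
| "shift_com k (While e c) = While (shift_expr k e) (shift_com k c)"

lemma eval_shift_expr: "eval_expr (shift_expr k e) s = eval_expr e (\<lambda>x. s (x + k))"
  by (induction e) auto

lemma cost_shift_expr: "expr_cost (shift_expr k e) s = expr_cost e (\<lambda>x. s (x + k))"
  by (induction e) (auto simp: eval_shift_expr)

text \<open>The store of a caller that keeps its own data \<open>S\<close> below \<open>k\<close>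
  while a subroutine works on its private store \<open>s\<close> from \<open>k\<close> on.\<close>

definition above :: "nat \<Rightarrow> store \<Rightarrow> store \<Rightarrow> store" where
  "above k S s = (\<lambda>x. if x < k then S x else s (x - k))"

lemma above_shift: "(\<lambda>x. above k S s (x + k)) = s"
  by (auto simp: above_def)

lemma above_upd: "(above k S s)(x + k := v) = above k S (s(x := v))"
  by (auto simp: above_def fun_eq_iff)

lemma run_shift: "run c s t s' \<Longrightarrow> run (shift_com k c) (above k S s) t (above k S s')"
proof (induction rule: run.induct)
  case (run_Assign x e s)
  show ?case
    using run.run_Assign[of "x + k" "shift_expr k e" "above k S s"]
    by (simp only: eval_shift_expr cost_shift_expr above_shift above_upd shift_com.simps)
next
  case (run_IfTrue e s c1 t s' c2)
  then show ?case
    using run.run_IfTrue[of "shift_expr k e" "above k S s" "shift_com k c1" t "above k S s'"]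
    by (simp add: eval_shift_expr cost_shift_expr above_shift)
next
  case (run_IfFalse e s c2 t s' c1)
  then show ?case
    using run.run_IfFalse[of "shift_expr k e" "above k S s" "shift_com k c2" t "above k S s'"]
    by (simp add: eval_shift_expr cost_shift_expr above_shift)
next
  case (run_WhileFalse e s c)
  then show ?case
    using run.run_WhileFalse[of "shift_expr k e" "above k S s" "shift_com k c"]
    by (simp add: eval_shift_expr cost_shift_expr above_shift)
next
  case (run_WhileTrue e s c t1 s1 t2 s2)
  then show ?case
    using run.run_WhileTrue[of "shift_expr k e" "above k S s" "shift_com k c" t1 "above k S s1"]
    by (simp add: eval_shift_expr cost_shift_expr above_shift)
qed (simp_all only: shift_com.simps run_Skip run_Seq)

abbreviation init_store :: "data \<Rightarrow> store" where
  "init_store x \<equiv> (\<lambda>_. NIL)(0 := x)"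

text \<open>Calling convention for subroutines: the argument stands in variable \<open>k\<close>,
  everything beyond is \<open>NIL\<close> as on a fresh start, and what the caller still needs lies
  below \<open>k\<close> and survives.\<close>

lemma run_within_shift:
  assumes "run_within c (init_store x) b (init_store y)" and "\<And>j. j > k \<Longrightarrow> S j = NIL" and "S k = x"
  shows "run_within (shift_com k c) S b (S(k := y))"
proof -
  have "S = above k S (init_store x)" "S(k := y) = above k S (init_store y)"
    using assms(2,3) by (auto simp: above_def fun_eq_iff)
  then show ?thesis
    using assms(1) run_shift unfolding run_within_def by metis
qed

text \<open>
  Programs are required to leave \<^const>\<open>NIL\<close> in all variables but \<open>0\<close>; hence they can be run one
  after the other, and shifted copies of them can be used as subroutines.
\<close>

definition polytime :: "(data \<Rightarrow> data) \<Rightarrow> bool" where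
  "polytime f \<longleftrightarrow>
     (\<exists>c p. \<forall>x. run_within c (init_store x) (poly p (dsize x)) (init_store (f x)))"

lemma polytimeI:
  assumes "\<And>x. run_within c (init_store x) (b (dsize x)) (init_store (f x))" and "poly_bounded b"
  shows "polytime f"
  using assms run_within_mono unfolding polytime_def poly_bounded_def by metis

lemma polytimeE:
  assumes "polytime f"
  obtains c p where "\<And>x. run_within c (init_store x) (poly p (dsize x)) (init_store (f x))"
    and "\<And>x. dsize (f x) \<le> poly p (dsize x)"
proof -
  obtain c p where c: "\<And>x. run_within c (init_store x) (poly p (dsize x)) (init_store (f x))"
    using assms unfolding polytime_def by blast
  have "dsize (f x) \<le> dsize x + poly p (dsize x)" for x
    using c[of x] unfolding run_within_def
    by (metis add_left_mono fun_upd_same order_trans run_dsize)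
  \<comment> \<open>One polynomial serves for time and size: the summand \<open>[:0, 1:]\<close>
    pays for the input, which may reappear in the output.\<close>
  then show ?thesis
    by (intro that[of c "[:0, 1:] + p"] run_within_mono[OF c]) auto
qed

lemma polytime_computable_on: "polytime f \<Longrightarrow> polytime_computable_on I f"
  unfolding polytime_def polytime_computable_on_def run_within_def by (metis fun_upd_same)

lemma polytime_compose:
  assumes "polytime f" and "polytime g"
  shows "polytime (\<lambda>x. f (g x))"
proof -
  obtain c p where c: "\<And>x. run_within c (init_store x) (poly p (dsize x)) (init_store (f x))"
    using polytimeE[OF assms(1)] by metis
  obtain d q where d: "\<And>x. run_within d (init_store x) (poly q (dsize x)) (init_store (g x))"
    and q: "\<And>x. dsize (g x) \<le> poly q (dsize x)"
    using polytimeE[OF assms(2)] by metis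
  show ?thesis
  proof (rule polytimeI)
    fix x
    show "run_within (Seq d c) (init_store x)
        (poly q (dsize x) + poly p (poly q (dsize x)) + 1) (init_store (f (g x)))"
      by (rule run_within_Seq[OF d run_within_mono[OF c]]) (rule poly_nat_mono[OF q])
  qed (intro poly_bounded_intros)
qed

text \<open>The cost of an expression bounds the size of its value, so each constructor at most
  doubles the linear constants of its arguments, up to an additive constant.\<close>

lemma polytime_expr: "polytime (\<lambda>x. eval_expr e (init_store x))"
proof -
  have "\<exists>k. \<forall>x. expr_cost e (init_store x) \<le> k * dsize x"
  proof (induction e)
    case (Var v)
    then show ?case by (intro exI[of _ 1]) (use dsize_pos in \<open>auto simp: Suc_le_eq\<close>)
  next
    case ENil
    then show ?case by (intro exI[of _ 1]) (use dsize_pos in \<open>auto simp: Suc_le_eq\<close>)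
  next
    case (ECons e f)
    then obtain k l where kl: "expr_cost e (init_store x) \<le> k * dsize x"
      "expr_cost f (init_store x) \<le> l * dsize x" for x by metis
    have "expr_cost (ECons e f) (init_store x) \<le> (2 * k + 2 * l + 1) * dsize x" for x
      using kl[of x] dsize_eval_expr[of e "init_store x"] dsize_eval_expr[of f "init_store x"]
        dsize_pos[of x] by (auto simp: algebra_simps)
    then show ?case by blast
  next
    case (Hd e)
    then obtain k where k: "expr_cost e (init_store x) \<le> k * dsize x" for x by metis
    have "expr_cost (Hd e) (init_store x) \<le> (2 * k) * dsize x" for x
      using k[of x] dsize_eval_expr[of e "init_store x"] dsize_dhd[of "eval_expr e (init_store x)"]
      by (auto simp: algebra_simps)
    then show ?case by blast
  next
    case (Tl e)
    then obtain k where k: "expr_cost e (init_store x) \<le> k * dsize x" for x by metis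
    have "expr_cost (Tl e) (init_store x) \<le> (2 * k) * dsize x" for x
      using k[of x] dsize_eval_expr[of e "init_store x"] dsize_dtl[of "eval_expr e (init_store x)"]
      by (auto simp: algebra_simps)
    then show ?case by blast
  next
    case (Eq e f)
    then obtain k l where kl: "expr_cost e (init_store x) \<le> k * dsize x"
      "expr_cost f (init_store x) \<le> l * dsize x" for x by metis
    have "expr_cost (Eq e f) (init_store x) \<le> (k + l + 3) * dsize x" for x
      using kl[of x] dsize_pos[of x] by (auto simp: algebra_simps)
    then show ?case by blast
  qed
  then obtain k where k: "expr_cost e (init_store x) \<le> k * dsize x" for x by blast
  show ?thesis
  proof (rule polytimeI)
    fix x
    show "run_within (Assign 0 e) (init_store x) (k * dsize x + 1)
        (init_store (eval_expr e (init_store x)))"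
      using k[of x] by (intro run_within_Assign[OF refl]) auto
  qed (intro poly_bounded_intros)
qed

lemma polytime_id: "polytime (\<lambda>x. x)"
  using polytime_expr[of "Var 0"] by simp

lemma polytime_hd: "polytime f \<Longrightarrow> polytime (\<lambda>x. dhd (f x))"
  using polytime_compose[OF polytime_expr[of "Hd (Var 0)"], of f] by simp

lemma polytime_tl: "polytime f \<Longrightarrow> polytime (\<lambda>x. dtl (f x))"
  using polytime_compose[OF polytime_expr[of "Tl (Var 0)"], of f] by simp

primrec expr_of :: "data \<Rightarrow> expr" where
  "expr_of NIL = ENil"
| "expr_of (CONS a b) = ECons (expr_of a) (expr_of b)"

lemma eval_expr_of: "eval_expr (expr_of d) s = d"
  by (induction d) auto

lemma polytime_const: "polytime (\<lambda>x. d)"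
  using polytime_expr[of "expr_of d"] by (simp add: eval_expr_of)

text \<open>Both programs need the input, so it stays in variable 0 while shifted copies run on
  copies of it: the first from variable 1 on, the second from variable 2 on, which leaves the first
  result intact.\<close>

lemma polytime_CONS:
  assumes "polytime f" and "polytime g"
  shows "polytime (\<lambda>x. CONS (f x) (g x))"
proof -
  obtain c p where c: "\<And>x. run_within c (init_store x) (poly p (dsize x)) (init_store (f x))"
    and p: "\<And>x. dsize (f x) \<le> poly p (dsize x)"
    using polytimeE[OF assms(1)] by metis
  obtain d q where d: "\<And>x. run_within d (init_store x) (poly q (dsize x)) (init_store (g x))"
    and q: "\<And>x. dsize (g x) \<le> poly q (dsize x)"
    using polytimeE[OF assms(2)] by metis
  let ?P = "Seq (Assign 1 (Var 0)) (Seq (shift_com 1 c) (Seq (Assign 2 (Var 0))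
     (Seq (shift_com 2 d) (Seq (Assign 0 (ECons (Var 1) (Var 2))) (Seq (Assign 1 ENil) (Assign 2 ENil))))))"
  show ?thesis
  proof (rule polytimeI)
    fix x
    let ?s0 = "init_store x"
    let ?s1 = "?s0(1 := x)" let ?s2 = "?s0(1 := f x)" let ?s3 = "?s2(2 := x)"
    let ?s4 = "?s2(2 := g x)" let ?s5 = "?s4(0 := CONS (f x) (g x))" let ?s6 = "?s5(1 := NIL)"
    have "run_within (Assign 1 (Var 0)) ?s0 (dsize x + 1) ?s1"
      by (rule run_within_Assign[OF refl]) (auto simp: fun_eq_iff)
    moreover have "run_within (shift_com 1 c) ?s1 (poly p (dsize x)) ?s2"
      using run_within_shift[OF c, of 1 ?s1 x] by simp
    moreover have "run_within (Assign 2 (Var 0)) ?s2 (dsize x + 1) ?s3"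
      by (rule run_within_Assign[OF refl]) (auto simp: fun_eq_iff)
    moreover have "run_within (shift_com 2 d) ?s3 (poly q (dsize x)) ?s4"
      using run_within_shift[OF d, of 2 ?s3 x] by simp
    moreover have "run_within (Assign 0 (ECons (Var 1) (Var 2))) ?s4
        (2 * (poly p (dsize x) + poly q (dsize x)) + 2) ?s5"
      by (rule run_within_Assign[OF refl]) (use p[of x] q[of x] in \<open>auto simp: fun_eq_iff\<close>)
    moreover have "run_within (Assign 1 ENil) ?s5 2 ?s6"
      by (rule run_within_Assign[OF refl]) (auto simp: fun_eq_iff)
    moreover have "run_within (Assign 2 ENil) ?s6 2 (init_store (CONS (f x) (g x)))"
      by (rule run_within_Assign[OF refl]) (auto simp: fun_eq_iff)
    ultimately show "run_within ?P ?s0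
       (dsize x + 1 + (poly p (dsize x) + (dsize x + 1 + (poly q (dsize x) +
         (2 * (poly p (dsize x) + poly q (dsize x)) + 2 + (2 + 2 + 1) + 1) + 1) + 1) + 1) + 1)
       (init_store (CONS (f x) (g x)))"
      by (blast intro: run_within_Seq)
  qed (intro poly_bounded_intros)
qed

lemma polytime_eq:
  assumes "polytime f" and "polytime g"
  shows "polytime (\<lambda>x. enc_bool (f x = g x))"
  using polytime_compose[OF polytime_expr[of "Eq (Hd (Var 0)) (Tl (Var 0))"]
      polytime_CONS[OF assms]]
  by (simp add: enc_bool_def)

text \<open>The test runs on a copy of the input in variable 1. Its result is erased at the start of
  each branch, because the branch programs are unshifted and expect \<open>NIL\<close> outside
  variable 0.\<close>

lemma polytime_if:
  assumes "polytime (\<lambda>x. enc_bool (b x))" and "polytime f" and "polytime g"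
  shows "polytime (\<lambda>x. if b x then f x else g x)"
proof -
  obtain c p where c: "\<And>x. run_within c (init_store x) (poly p (dsize x)) (init_store (enc_bool (b x)))"
    using polytimeE[OF assms(1)] by metis
  obtain d q where d: "\<And>x. run_within d (init_store x) (poly q (dsize x)) (init_store (f x))"
    using polytimeE[OF assms(2)] by metis
  obtain e r where e: "\<And>x. run_within e (init_store x) (poly r (dsize x)) (init_store (g x))"
    using polytimeE[OF assms(3)] by metis
  let ?P = "Seq (Assign 1 (Var 0)) (Seq (shift_com 1 c)
     (If (Var 1) (Seq (Assign 1 ENil) d) (Seq (Assign 1 ENil) e)))"
  show ?thesis
  proof (rule polytimeI)
    fix x
    let ?s0 = "init_store x"
    let ?s1 = "?s0(1 := x)" let ?s2 = "?s0(1 := enc_bool (b x))"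
    let ?y = "if b x then f x else g x"
    have nil: "run_within (Assign 1 ENil) ?s2 2 ?s0"
      by (rule run_within_Assign[OF refl]) (auto simp: fun_eq_iff)
    have "run_within (Assign 1 (Var 0)) ?s0 (dsize x + 1) ?s1"
      by (rule run_within_Assign[OF refl]) (auto simp: fun_eq_iff)
    moreover have "run_within (shift_com 1 c) ?s1 (poly p (dsize x)) ?s2"
      using run_within_shift[OF c, of 1 ?s1 x] by simp
    moreover have "run_within (If (Var 1) (Seq (Assign 1 ENil) d) (Seq (Assign 1 ENil) e)) ?s2
        (3 + (2 + (poly q (dsize x) + poly r (dsize x)) + 1) + 1) (init_store ?y)"
    proof (rule run_within_mono[OF run_within_If])
      show "run_within (if eval_expr (Var 1) ?s2 = NIL then Seq (Assign 1 ENil) e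
          else Seq (Assign 1 ENil) d) ?s2 (2 + (poly q (dsize x) + poly r (dsize x)) + 1)
          (init_store ?y)"
      proof (cases "b x")
        case True
        have "run_within (Seq (Assign 1 ENil) d) ?s2 (2 + (poly q (dsize x) + poly r (dsize x)) + 1)
          (init_store (f x))"
          by (rule run_within_Seq[OF nil run_within_mono[OF d]]) simp
        with True show ?thesis by (simp add: enc_bool_def)
      next
        case False
        have "run_within (Seq (Assign 1 ENil) e) ?s2 (2 + (poly q (dsize x) + poly r (dsize x)) + 1)
          (init_store (g x))"
          by (rule run_within_Seq[OF nil run_within_mono[OF e]]) simp
        with False show ?thesis by (simp add: enc_bool_def)
      qed
    qed (simp add: enc_bool_def)
    ultimately show "run_within ?P ?s0
       (dsize x + 1 + (poly p (dsize x) +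
         (3 + (2 + (poly q (dsize x) + poly r (dsize x)) + 1) + 1) + 1) + 1) (init_store ?y)"
      by (blast intro: run_within_Seq)
  qed (intro poly_bounded_intros)
qed

section \<open>Trees as lists, and folds over them\<close>

primrec dlist :: "data \<Rightarrow> data list" where
  "dlist NIL = []"
| "dlist (CONS a b) = a # dlist b"

abbreviation of_dlist :: "data list \<Rightarrow> data" where
  "of_dlist \<equiv> enc_list (\<lambda>x. x)"

lemma dlist_enc_list [simp]: "dlist (enc_list f xs) = map f xs"
  by (induction xs) auto

lemma enc_list_conv: "enc_list f xs = of_dlist (map f xs)"
  by (induction xs) auto

lemma of_dlist_dlist [simp]: "of_dlist (dlist d) = d"
  by (induction d) auto

lemma dsize_of_dlist: "dsize (of_dlist xs) = (\<Sum>x\<leftarrow>xs. dsize x + 1) + 1"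
  by (induction xs) auto

lemma length_dlist: "length (dlist d) \<le> dsize d"
  by (induction d) auto

lemma dsize_in_dlist: "a \<in> set (dlist d) \<Longrightarrow> dsize a \<le> dsize d"
  by (induction d) auto

text \<open>A polynomial bound for a single step would allow an exponentially growing accumulator.
  Hence a size bound is demanded after every prefix \<open>as\<close> of the list. The step may also
  read the input \<open>x\<close> of the whole fold.\<close>

lemma polytime_foldl:
  assumes step: "polytime (\<lambda>p. g (dhd p) (dhd (dtl p)) (dtl (dtl p)))"
    and init: "polytime i" and list: "polytime l"
    and bounded: "\<And>x as bs. dlist (l x) = as @ bs \<Longrightarrow> dsize (foldl (g x) (i x) as) \<le> b (dsize x)"
      "poly_bounded b"
  shows "polytime (\<lambda>x. foldl (g x) (i x) (dlist (l x)))"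
proof -
  let ?G = "\<lambda>p. g (dhd p) (dhd (dtl p)) (dtl (dtl p))"
  obtain c p where c: "\<And>x. run_within c (init_store x) (poly p (dsize x)) (init_store (?G x))"
    using polytimeE[OF step] by metis
  obtain d q where d: "\<And>x. run_within d (init_store x) (poly q (dsize x)) (init_store (i x))"
    using polytimeE[OF init] by metis
  obtain e r where e: "\<And>x. run_within e (init_store x) (poly r (dsize x)) (init_store (l x))"
    and r: "\<And>x. dsize (l x) \<le> poly r (dsize x)"
    using polytimeE[OF list] by metis
  obtain w where w: "\<And>n. b n \<le> poly w n"
    using bounded(2) unfolding poly_bounded_def by blast
  let ?E = "ECons (Var 0) (ECons (Var 2) (Hd (Var 1)))"
  let ?body = "Seq (Assign 3 ?E) (Seq (shift_com 3 c)
    (Seq (Assign 2 (Var 3)) (Seq (Assign 3 ENil) (Assign 1 (Tl (Var 1))))))"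
  let ?P = "Seq (Assign 1 (Var 0)) (Seq (shift_com 1 e) (Seq (Assign 2 (Var 0)) (Seq (shift_com 2 d)
     (Seq (While (Var 1) ?body) (Seq (Assign 0 (Var 2)) (Assign 2 ENil))))))"
  \<comment> \<open>\<open>?B\<close> bounds one pass through the body for an input of size
    \<open>n\<close>; \<open>?T\<close> adds the loop test.\<close>
  let ?B = "\<lambda>n. 3 * (n + poly w n + poly r n + 2) + 3 * poly r n +
      (poly p (n + poly w n + poly r n + 2) + (poly w n + 1 + (2 + (2 * poly r n + 1) + 1) + 1) + 1) + 1"
  let ?T = "\<lambda>n. ?B n + poly r n + 1"
  show ?thesis
  proof (rule polytimeI)
    fix x
    define n where "n = dsize x"
    define st where "st m acc = (init_store x)(1 := m, 2 := acc)" for m acc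
    let ?y = "foldl (g x) (i x) (dlist (l x))"
    \<comment> \<open>Loop invariant: \<open>as\<close> has been consumed and \<open>m\<close> is
      left. The additive 2 pays for the final failing test.\<close>
    have loop: "run_within (While (Var 1) ?body) (st m (foldl (g x) (i x) as))
        (length (dlist m) * ?T n + 2) (st NIL ?y)"
      if "dlist (l x) = as @ dlist m" for as m
      using that
    proof (induction m arbitrary: as)
      case NIL
      then have "foldl (g x) (i x) as = ?y" by simp
      then show ?case
        by (simp only:, intro run_within_run[OF run_WhileFalse]) (simp_all add: st_def)
    next
      case (CONS a m)
      let ?acc = "foldl (g x) (i x) as" let ?acc' = "g x ?acc a"
      have acc: "dsize ?acc \<le> poly w n" "dsize ?acc' \<le> poly w n"
        using bounded(1)[of x as "a # dlist m"] bounded(1)[of x "as @ [a]" "dlist m"] CONS.prems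
          w[of n] by (auto simp: n_def)
      have "dsize (of_dlist (a # dlist m)) \<le> dsize (of_dlist (as @ a # dlist m))"
        unfolding dsize_of_dlist by simp
      also have "of_dlist (as @ a # dlist m) = l x"
        using CONS.prems by (metis dlist.simps(2) of_dlist_dlist)
      finally have m: "dsize (CONS a m) \<le> poly r n"
        using r[of x] by (simp add: n_def)
      let ?arg = "CONS x (CONS ?acc a)"
      let ?s0 = "st (CONS a m) ?acc" let ?s1 = "?s0(3 := ?arg)" let ?s2 = "?s0(3 := ?acc')"
      let ?s3 = "?s2(2 := ?acc')" let ?s4 = "st (CONS a m) ?acc'"
      have "run_within (Assign 3 ?E) ?s0
          (3 * (n + poly w n + poly r n + 2) + 3 * poly r n) ?s1"
        by (rule run_within_Assign[OF refl]) (use acc m n_def in \<open>auto simp: st_def fun_eq_iff\<close>)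
      moreover have "run_within (shift_com 3 c) ?s1 (poly p (n + poly w n + poly r n + 2)) ?s2"
      proof -
        have "poly p (dsize ?arg) \<le> poly p (n + poly w n + poly r n + 2)"
          by (rule poly_nat_mono) (use acc m n_def in simp)
        from run_within_mono[OF c[of ?arg] this] show ?thesis
          using run_within_shift[of c ?arg _ ?acc' 3 ?s1] by (simp add: st_def)
      qed
      moreover have "run_within (Assign 2 (Var 3)) ?s2 (poly w n + 1) ?s3"
        by (rule run_within_Assign[OF refl]) (use acc in \<open>auto simp: st_def fun_eq_iff\<close>)
      moreover have "run_within (Assign 3 ENil) ?s3 2 ?s4"
        by (rule run_within_Assign[OF refl]) (auto simp: st_def fun_eq_iff)
      moreover have "run_within (Assign 1 (Tl (Var 1))) ?s4 (2 * poly r n + 1) (st m ?acc')"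
        by (rule run_within_Assign[OF refl]) (use m in \<open>auto simp: st_def fun_eq_iff\<close>)
      ultimately have body: "run_within ?body ?s0 (?B n) (st m ?acc')"
        by (blast intro: run_within_Seq)
      have rest: "run_within (While (Var 1) ?body) (st m ?acc') (length (dlist m) * ?T n + 2) (st NIL ?y)"
        using CONS.IH(2)[of "as @ [a]"] CONS.prems by simp
      obtain t1 t2 where t: "t1 \<le> ?B n" "run ?body ?s0 t1 (st m ?acc')"
        "t2 \<le> length (dlist m) * ?T n + 2" "run (While (Var 1) ?body) (st m ?acc') t2 (st NIL ?y)"
        using body rest unfolding run_within_def by blast
      have "run (While (Var 1) ?body) ?s0 (expr_cost (Var 1) ?s0 + t1 + t2 + 1) (st NIL ?y)"
        by (rule run_WhileTrue[OF _ t(2,4)]) (simp add: st_def)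
      moreover have "expr_cost (Var 1) ?s0 + t1 + t2 + 1 \<le> length (dlist (CONS a m)) * ?T n + 2"
        using t(1,3) m by (simp add: st_def)
      ultimately show ?case unfolding run_within_def by blast
    qed
    let ?s0 = "init_store x"
    have y: "dsize ?y \<le> poly w n"
      using bounded(1)[of x "dlist (l x)" "[]"] w[of n] by (simp add: n_def)
    have "run_within (Assign 1 (Var 0)) ?s0 (n + 1) (?s0(1 := x))"
      by (rule run_within_Assign[OF refl]) (auto simp: st_def n_def fun_eq_iff)
    moreover have "run_within (shift_com 1 e) (?s0(1 := x)) (poly r n) (?s0(1 := l x))"
      using run_within_shift[OF e, of 1 "?s0(1 := x)" x] by (simp add: n_def)
    moreover have "run_within (Assign 2 (Var 0)) (?s0(1 := l x)) (n + 1) (st (l x) x)"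
      by (rule run_within_Assign[OF refl]) (auto simp: st_def n_def fun_eq_iff)
    moreover have "run_within (shift_com 2 d) (st (l x) x) (poly q n) (st (l x) (i x))"
      using run_within_shift[OF d, of 2 "st (l x) x" x] by (simp add: n_def st_def)
    moreover have "run_within (While (Var 1) ?body) (st (l x) (i x)) (poly r n * ?T n + 2) (st NIL ?y)"
    proof -
      have "length (dlist (l x)) \<le> poly r n"
        using length_dlist[of "l x"] r[of x] by (simp add: n_def)
      then have "length (dlist (l x)) * ?T n + 2 \<le> poly r n * ?T n + 2"
        by (intro add_right_mono mult_right_mono) auto
      with loop[of "[]" "l x"] show ?thesis by (auto elim: run_within_mono)
    qed
    moreover have "run_within (Assign 0 (Var 2)) (st NIL ?y) (poly w n + 1) ((st NIL ?y)(0 := ?y))"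
      by (rule run_within_Assign[OF refl]) (use y in \<open>auto simp: st_def fun_eq_iff\<close>)
    moreover have "run_within (Assign 2 ENil) ((st NIL ?y)(0 := ?y)) 2 (init_store ?y)"
      by (rule run_within_Assign[OF refl]) (auto simp: st_def n_def fun_eq_iff)
    ultimately have "run_within ?P ?s0 (n + 1 + (poly r n + (n + 1 + (poly q n +
        (poly r n * ?T n + 2 + (poly w n + 1 + 2 + 1) + 1) + 1) + 1) + 1) + 1) (init_store ?y)"
      by (blast intro: run_within_Seq)
    then show "run_within ?P ?s0 ((\<lambda>n. n + 1 + (poly r n + (n + 1 + (poly q n +
        (poly r n * ?T n + 2 + (poly w n + 1 + 2 + 1) + 1) + 1) + 1) + 1) + 1) (dsize x)) (init_store ?y)"
      by (simp add: n_def)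
  qed (intro poly_bounded_intros)
qed

lemma dsize_dhd_dtl: "dsize (dhd x) + dsize (dtl x) \<le> dsize x + 1"
  by (cases x) auto

text \<open>If the increment of a step does not depend on the accumulator, all increments together
  are at most the length of the list times the largest one, and both factors are polynomial in the
  input size.\<close>

lemma polytime_foldl_additive:
  assumes step: "polytime (\<lambda>p. g (dhd p) (dhd (dtl p)) (dtl (dtl p)))"
    and init: "polytime i" and list: "polytime l"
    and additive: "\<And>x acc a. dsize (g x acc a) \<le> dsize acc + b (dsize x + dsize a)"
    and b: "poly_bounded b"
  shows "polytime (\<lambda>x. foldl (g x) (i x) (dlist (l x)))"
proof -
  obtain q where q: "\<And>x. dsize (i x) \<le> poly q (dsize x)"
    using polytimeE[OF init] by metis
  obtain r where r: "\<And>x. dsize (l x) \<le> poly r (dsize x)"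
    using polytimeE[OF list] by metis
  obtain w where w: "\<And>n. b n \<le> poly w n"
    using b unfolding poly_bounded_def by blast
  show ?thesis
  proof (rule polytime_foldl[OF step init list])
    fix x as bs assume as: "dlist (l x) = as @ bs"
    let ?B = "poly w (dsize x + poly r (dsize x))"
    have "dsize a \<le> poly r (dsize x)" if "a \<in> set as" for a
      using that dsize_in_dlist[of a "l x"] as r[of x] by auto
    then have "dsize (foldl (g x) (i x) as) \<le> dsize (i x) + length as * ?B"
    proof (induction as rule: rev_induct)
      case (snoc a as)
      have "b (dsize x + dsize a) \<le> ?B"
        using w[of "dsize x + dsize a"] snoc.prems[of a]
          poly_nat_mono[of "dsize x + dsize a" "dsize x + poly r (dsize x)" w] by simp
      with snoc additive[of x "foldl (g x) (i x) as" a] show ?case by simp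
    qed simp
    also have "\<dots> \<le> poly q (dsize x) + poly r (dsize x) * ?B"
      using q[of x] length_dlist[of "l x"] r[of x] as by (intro add_mono mult_right_mono) auto
    finally show "dsize (foldl (g x) (i x) as) \<le> poly q (dsize x) + poly r (dsize x) * ?B" .
  qed (intro poly_bounded_intros)
qed

section \<open>Pairs of arguments, Boolean connectives and list operations\<close>

lemma polytime_compose2:
  assumes "polytime (\<lambda>p. h (dhd p) (dtl p))" and "polytime f" and "polytime g"
  shows "polytime (\<lambda>x. h (f x) (g x))"
  using polytime_compose[OF assms(1) polytime_CONS[OF assms(2,3)]] by simp

lemma polytime_not:
  assumes "polytime (\<lambda>x. enc_bool (P x))"
  shows "polytime (\<lambda>x. enc_bool (\<not> P x))"
proof -
  have "(\<lambda>x. enc_bool (\<not> P x)) = (\<lambda>x. if P x then NIL else CONS NIL NIL)"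
    by (auto simp: enc_bool_def)
  then show ?thesis
    using polytime_if[OF assms polytime_const polytime_const] by simp
qed

lemma polytime_conj:
  assumes "polytime (\<lambda>x. enc_bool (P x))" and "polytime (\<lambda>x. enc_bool (Q x))"
  shows "polytime (\<lambda>x. enc_bool (P x \<and> Q x))"
proof -
  have "(\<lambda>x. enc_bool (P x \<and> Q x)) = (\<lambda>x. if P x then enc_bool (Q x) else NIL)"
    by (auto simp: enc_bool_def)
  then show ?thesis
    using polytime_if[OF assms polytime_const] by simp
qed

lemma polytime_disj:
  assumes "polytime (\<lambda>x. enc_bool (P x))" and "polytime (\<lambda>x. enc_bool (Q x))"
  shows "polytime (\<lambda>x. enc_bool (P x \<or> Q x))"
  using polytime_not[OF polytime_conj[OF polytime_not[OF assms(1)] polytime_not[OF assms(2)]]]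
  by simp

lemma polytime_rev:
  assumes "polytime l"
  shows "polytime (\<lambda>x. of_dlist (rev (dlist (l x))))"
proof -
  have "foldl (\<lambda>acc a. CONS a acc) (of_dlist ys) xs = of_dlist (rev xs @ ys)" for xs ys
  proof (induction xs arbitrary: ys)
    case (Cons x xs)
    then show ?case using Cons.IH[of "x # ys"] by simp
  qed simp
  from this[of "[]"]
  have eq: "(\<lambda>x. of_dlist (rev (dlist (l x)))) = (\<lambda>x. foldl (\<lambda>acc a. CONS a acc) NIL (dlist (l x)))"
    by simp
  show ?thesis
    unfolding eq
    by (rule polytime_foldl_additive[where b = "\<lambda>n. n + 1"])
      (use assms in \<open>simp_all add: polytime_CONS polytime_const polytime_id polytime_hd polytime_tl
         poly_bounded_add poly_bounded_id poly_bounded_const del: add_Suc_right\<close>)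
qed

text \<open>The fold conses the images in reverse order, so its result is reversed
  afterwards.\<close>

lemma polytime_map_filter:
  assumes h: "polytime (\<lambda>p. h (dhd p) (dtl p))" and P: "polytime (\<lambda>p. enc_bool (P (dhd p) (dtl p)))"
    and "polytime l"
  shows "polytime (\<lambda>x. of_dlist (map (h x) (filter (P x) (dlist (l x)))))"
proof -
  let ?g = "\<lambda>x acc a. if P x a then CONS (h x a) acc else acc"
  obtain w where w: "\<And>p. dsize (h (dhd p) (dtl p)) \<le> poly w (dsize p)"
    using polytimeE[OF h] by metis
  have fold: "foldl (?g x) (of_dlist ys) xs = of_dlist (rev (map (h x) (filter (P x) xs)) @ ys)"
    for x xs ys
  proof (induction xs arbitrary: ys)
    case (Cons a xs)
    then show ?case using Cons.IH[of "h x a # ys"] by simp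
  qed simp
  \<comment> \<open>Drops the accumulator from the argument of a step, leaving the pair that
    \<open>h\<close> and \<open>P\<close> expect.\<close>
  have env: "polytime (\<lambda>p. CONS (dhd p) (dtl (dtl p)))"
    by (intro polytime_CONS polytime_hd polytime_tl polytime_id)
  have "polytime (\<lambda>x. foldl (?g x) NIL (dlist (l x)))"
  proof (rule polytime_foldl_additive[where b = "\<lambda>n. poly w (n + 1) + 1"])
    show "polytime (\<lambda>p. ?g (dhd p) (dhd (dtl p)) (dtl (dtl p)))"
      using polytime_compose[OF h env] polytime_compose[OF P env]
      by (intro polytime_if polytime_CONS polytime_hd polytime_tl polytime_id) simp_all
    show "dsize (?g x acc a) \<le> dsize acc + (poly w (dsize x + dsize a + 1) + 1)" for x acc a
      using w[of "CONS x a"] by simp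
    show "poly_bounded (\<lambda>n. poly w (n + 1) + 1)"
      by (intro poly_bounded_intros)
  qed (use assms polytime_const in auto)
  from polytime_rev[OF this] show ?thesis
    using fold[where ys = "[]"] by simp
qed

lemma polytime_map:
  assumes "polytime (\<lambda>p. h (dhd p) (dtl p))" and "polytime l"
  shows "polytime (\<lambda>x. of_dlist (map (h x) (dlist (l x))))"
  using polytime_map_filter[of h "\<lambda>_ _. True" l] assms polytime_const by simp

lemma polytime_filter:
  assumes "polytime (\<lambda>p. enc_bool (P (dhd p) (dtl p)))" and "polytime l"
  shows "polytime (\<lambda>x. of_dlist (filter (P x) (dlist (l x))))"
  using polytime_map_filter[of "\<lambda>_ a. a" P l] assms polytime_tl[OF polytime_id] by simp

lemmas polytime_intros =
  polytime_hd polytime_tl polytime_id polytime_const polytime_CONS polytime_if polytime_not polytime_conj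
  polytime_disj polytime_eq polytime_map polytime_filter polytime_map_filter


section \<open>Solving equations between variables\<close>

text \<open>
  The solution of a list of equations is a triangular substitution, with the most recent binding
  at the head of the list.
\<close>

fun subst :: "(nat \<times> nat) list \<Rightarrow> nat \<Rightarrow> nat" where
  "subst [] z = z"
| "subst ((a, b) # S) z = (if subst S z = a then b else subst S z)"

text \<open>Both sides are replaced by their current representatives before one is bound to the
  other. Older bindings are never rewritten, and an equation that already holds adds a harmless
  binding of a variable to itself.\<close>

fun add_equation :: "(nat \<times> nat) list \<Rightarrow> 'r atom \<Rightarrow> (nat \<times> nat) list" where
  "add_equation S (REq x y) = (subst S x, subst S y) # S"
| "add_equation S _ = S"

definition solve_equations :: "'r atom list \<Rightarrow> (nat \<times> nat) list" where
  "solve_equations \<phi> = foldl add_equation [] \<phi>"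

lemma solve_equations_snoc:
  "solve_equations (\<phi> @ [\<alpha>]) = add_equation (solve_equations \<phi>) \<alpha>"
  by (simp add: solve_equations_def)

text \<open>Only representatives are bound, and only to representatives. The fixed points of the
  substitution are thus its values, and they can serve as elements of the database.\<close>

lemma subst_idem: "subst (solve_equations \<phi>) (subst (solve_equations \<phi>) z) = subst (solve_equations \<phi>) z"
proof (induction \<phi> arbitrary: z rule: rev_induct)
  case (snoc \<alpha> \<phi>)
  then show ?case by (cases \<alpha>) (auto simp: solve_equations_snoc)
qed (simp add: solve_equations_def)

lemma subst_solves:
  "REq x y \<in> set \<phi> \<Longrightarrow> subst (solve_equations \<phi>) x = subst (solve_equations \<phi>) y"
proof (induction \<phi> arbitrary: x y rule: rev_induct)
  case (snoc \<alpha> \<phi>)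
  then show ?case by (cases \<alpha>) (auto simp: solve_equations_snoc)
qed simp

text \<open>Each binding identifies two variables on which \<open>a\<close> already agrees. So
  passing to representatives loses no assignment that satisfies the equations.\<close>

lemma subst_most_general:
  assumes "\<And>x y. REq x y \<in> set \<phi> \<Longrightarrow> a x = a y"
  shows "a (subst (solve_equations \<phi>) z) = a z"
  using assms
proof (induction \<phi> arbitrary: z rule: rev_induct)
  case (snoc \<alpha> \<phi>)
  then have IH: "a (subst (solve_equations \<phi>) z) = a z" for z by auto
  show ?case
  proof (cases \<alpha>)
    case (REq x y)
    then have "a x = a y" using snoc.prems by simp
    then show ?thesis
      using IH[of x] IH[of y] IH[of z] REq by (auto simp: solve_equations_snoc)
  qed (simp_all add: solve_equations_snoc IH)
qed (simp add: solve_equations_def)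

lemma subst_in:
  assumes "\<forall>\<alpha>\<in>set \<phi>. is_atom \<tau> ar X \<alpha>" and "z \<in> X"
  shows "subst (solve_equations \<phi>) z \<in> X"
  using assms
proof (induction \<phi> arbitrary: z rule: rev_induct)
  case (snoc \<alpha> \<phi>)
  then show ?case by (cases \<alpha>) (auto simp: solve_equations_snoc)
qed (simp add: solve_equations_def)

text \<open>The list is reversed because \<open>subst\<close> applies the oldest binding, at the end
  of the list, first.\<close>

definition subst_data :: "data \<Rightarrow> data \<Rightarrow> data" where
  "subst_data S z = foldl (\<lambda>z p. if z = dhd p then dtl p else z) z (rev (dlist S))"

lemma polytime_subst_data:
  assumes "polytime f" and "polytime g"
  shows "polytime (\<lambda>x. subst_data (f x) (g x))"
proof (rule polytime_compose2[OF _ assms])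
  have "polytime (\<lambda>p. foldl (\<lambda>z p. if z = dhd p then dtl p else z) (dtl p)
      (dlist (of_dlist (rev (dlist (dhd p))))))"
  proof (rule polytime_foldl_additive[where b = "\<lambda>n. n"])
    show "dsize (if acc = dhd a then dtl a else acc) \<le> dsize acc + (dsize x + dsize a)" for x acc a :: data
      using dsize_dtl[of a] by simp
  qed (intro polytime_intros polytime_rev poly_bounded_id)+
  then show "polytime (\<lambda>p. subst_data (dhd p) (dtl p))"
    by (simp add: subst_data_def)
qed

definition solve_data :: "data \<Rightarrow> data" where
  "solve_data \<phi> = foldl (\<lambda>S \<alpha>. if dhd \<alpha> = enc_nat 1
     then CONS (CONS (subst_data S (dhd (dtl \<alpha>))) (subst_data S (dtl (dtl \<alpha>)))) S else S) NIL (dlist \<phi>)"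

text \<open>A replacement is always the second component of a binding, so lookups create nothing
  new. The number \<open>2 * n + 1\<close> bounds a pair of trees of size at most
  \<open>n\<close>.\<close>

lemma dsize_subst_data:
  assumes "\<forall>p\<in>set (dlist S). dsize p \<le> 2 * n + 1 \<and> dsize (dtl p) \<le> n" and "dsize z \<le> n"
  shows "dsize (subst_data S z) \<le> n"
  using assms unfolding subst_data_def foldl_conv_foldr rev_rev_ident
  by (induction S) auto

text \<open>The step inserts values looked up in its own accumulator, so its growth is not bounded
  independently of the accumulator. What helps is that all these values are copied from the
  input.\<close>

lemma polytime_solve_data:
  assumes "polytime f"
  shows "polytime (\<lambda>x. solve_data (f x))"
proof (rule polytime_compose[OF _ assms])
  let ?g = "\<lambda>S \<alpha>. if dhd \<alpha> = enc_nat 1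
     then CONS (CONS (subst_data S (dhd (dtl \<alpha>))) (subst_data S (dtl (dtl \<alpha>)))) S else S"
  show "polytime solve_data"
    unfolding solve_data_def
  proof (rule polytime_foldl[where b = "\<lambda>n. n * (2 * n + 2) + 1"])
    fix x as bs assume as: "dlist x = as @ bs"
    let ?n = "dsize x"
    \<comment> \<open>\<open>2 * ?n + 2\<close> is one binding with its list cell; the second
      conjunct keeps the looked-up values small.\<close>
    have "dsize (foldl ?g NIL as) \<le> length as * (2 * ?n + 2) + 1 \<and>
        (\<forall>p\<in>set (dlist (foldl ?g NIL as)). dsize p \<le> 2 * ?n + 1 \<and> dsize (dtl p) \<le> ?n)"
      if "\<forall>a\<in>set as. dsize a \<le> ?n"
      using that
    proof (induction as rule: rev_induct)
      case (snoc a as)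
      let ?S = "foldl ?g NIL as"
      have IH: "dsize ?S \<le> length as * (2 * ?n + 2) + 1"
        "\<forall>p\<in>set (dlist ?S). dsize p \<le> 2 * ?n + 1 \<and> dsize (dtl p) \<le> ?n"
        using snoc by auto
      have "dsize (dhd (dtl a)) \<le> ?n" "dsize (dtl (dtl a)) \<le> ?n"
        using snoc.prems dsize_dtl[of a] dsize_dhd[of "dtl a"] dsize_dtl[of "dtl a"] by auto
      then have "dsize (subst_data ?S (dhd (dtl a))) \<le> ?n" "dsize (subst_data ?S (dtl (dtl a))) \<le> ?n"
        using dsize_subst_data[OF IH(2)] by blast+
      with IH show ?case by (simp del: One_nat_def)
    qed simp
    moreover have "\<forall>a\<in>set as. dsize a \<le> ?n"
      using as dsize_in_dlist[of _ x] by auto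
    ultimately have "dsize (foldl ?g NIL as) \<le> length as * (2 * ?n + 2) + 1" by blast
    also have "\<dots> \<le> ?n * (2 * ?n + 2) + 1"
      using as length_dlist[of x] by (intro add_right_mono mult_right_mono) auto
    finally show "dsize (foldl ?g NIL as) \<le> ?n * (2 * ?n + 2) + 1" .
  qed (intro polytime_intros polytime_subst_data poly_bounded_intros)+
qed

abbreviation enc_pair :: "nat \<times> nat \<Rightarrow> data" where
  "enc_pair \<equiv> (\<lambda>(a, b). CONS (enc_nat a) (enc_nat b))"

lemma subst_data_enc: "subst_data (enc_list enc_pair S) (enc_nat z) = enc_nat (subst S z)"
  unfolding subst_data_def foldl_conv_foldr rev_rev_ident by (induction S) auto

lemma solve_data_enc: "solve_data (enc_list enc_atom \<phi>) = enc_list enc_pair (solve_equations \<phi>)"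
proof (induction \<phi> rule: rev_induct)
  case (snoc \<alpha> \<phi>)
  then show ?case
    by (cases \<alpha>) (simp_all add: solve_data_def solve_equations_snoc subst_data_enc)
qed (simp add: solve_data_def solve_equations_def)


section \<open>Binary division with remainder\<close>

text \<open>A full subtractor. The state \<open>s\<close> holds the remaining bits of the
  subtrahend, the borrow and the difference so far. The new borrow is the majority of the negated
  bit \<open>a\<close>, the subtrahend bit and the old borrow; the nested equality is the exclusive
  or of the three bits. The default \<open>dhd NIL = NIL\<close> pads a short subtrahend with
  zeros.\<close>

definition subtract_step :: "data \<Rightarrow> data \<Rightarrow> data" where
  "subtract_step s a = CONS (dtl (dhd s)) (CONS
     (enc_bool (if a \<noteq> NIL then dhd (dhd s) \<noteq> NIL \<and> dhd (dtl s) \<noteq> NIL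
        else dhd (dhd s) \<noteq> NIL \<or> dhd (dtl s) \<noteq> NIL))
     (CONS (enc_bool ((a \<noteq> NIL) = ((dhd (dhd s) \<noteq> NIL) = (dhd (dtl s) \<noteq> NIL)))) (dtl (dtl s))))"

text \<open>
  The result consists of the unused part of the subtrahend, the last borrow and the bits of the
  difference, most significant bit first. The difference is negative iff one of the first two
  is non-zero.
\<close>

definition subtract_data :: "data \<Rightarrow> data \<Rightarrow> data" where
  "subtract_data m n = foldl subtract_step (CONS n (CONS NIL NIL)) (dlist m)"

text \<open>The state \<open>s\<close> holds remainder and quotient so far; consing the next
  dividend bit onto the remainder doubles it and adds the bit. A difference is reversed back to
  least significant bit first. No zero is consed onto an empty quotient, since the result must be
  the canonical \<open>enc_nat\<close>; the remainder may carry leading zeros.\<close>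

definition divide_step :: "data \<Rightarrow> data \<Rightarrow> data \<Rightarrow> data" where
  "divide_step d s a =
     (let r = CONS (enc_bool (a \<noteq> NIL)) (dhd s); t = subtract_data r d in
      if dhd t = NIL \<and> dhd (dtl t) = NIL
      then CONS (of_dlist (rev (dlist (dtl (dtl t))))) (CONS (enc_bool True) (dtl s))
      else CONS r (if dtl s = NIL then NIL else CONS NIL (dtl s)))"

definition divide_data :: "data \<Rightarrow> data \<Rightarrow> data" where
  "divide_data n d = dtl (foldl (divide_step d) (CONS NIL NIL) (rev (dlist n)))"

lemma polytime_subtract_data:
  assumes "polytime f" and "polytime g"
  shows "polytime (\<lambda>x. subtract_data (f x) (g x))"
proof (rule polytime_compose2[OF _ assms])
  show "polytime (\<lambda>p. subtract_data (dhd p) (dtl p))"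
    unfolding subtract_data_def
  proof (rule polytime_foldl_additive[where b = "\<lambda>_. 12"])
    \<comment> \<open>Equality of truth values becomes equality of encoded truth values, the form in
      which \<open>polytime_eq\<close> applies.\<close>
    have eq: "(\<lambda>p. subtract_step (dhd (dtl p)) (dtl (dtl p))) = (\<lambda>p. CONS (dtl (dhd (dhd (dtl p)))) (CONS
     (if dtl (dtl p) \<noteq> NIL then enc_bool (dhd (dhd (dhd (dtl p))) \<noteq> NIL \<and> dhd (dtl (dhd (dtl p))) \<noteq> NIL)
        else enc_bool (dhd (dhd (dhd (dtl p))) \<noteq> NIL \<or> dhd (dtl (dhd (dtl p))) \<noteq> NIL))
     (CONS (enc_bool (enc_bool (dtl (dtl p) \<noteq> NIL) =
         enc_bool (enc_bool (dhd (dhd (dhd (dtl p))) \<noteq> NIL) = enc_bool (dhd (dtl (dhd (dtl p))) \<noteq> NIL))))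
       (dtl (dtl (dhd (dtl p)))))))"
      by (auto simp: fun_eq_iff subtract_step_def enc_bool_def)
    show "polytime (\<lambda>p. subtract_step (dhd (dtl p)) (dtl (dtl p)))"
      unfolding eq by (intro polytime_intros)
    \<comment> \<open>Two new bits of size at most 3 and a few cells; 12 is generous.\<close>
    show "dsize (subtract_step acc a) \<le> dsize acc + 12" for acc a
      using dsize_dhd_dtl[of acc] dsize_dtl[of "dhd acc"] dsize_dtl[of "dtl acc"]
      by (simp add: subtract_step_def enc_bool_def)
  qed (intro polytime_intros poly_bounded_intros)+
qed

text \<open>Needed for the time bound, hence for arbitrary trees instead of encoded numbers: each
  bit of the minuend yields one bit of size at most 3, whatever the subtrahend is.\<close>

lemma subtract_steps:
  assumes "\<forall>b\<in>set (dlist out). dsize b \<le> 3"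
  shows "length (dlist (dtl (dtl (foldl subtract_step (CONS n (CONS c out)) as)))) =
      length as + length (dlist out) \<and>
    (\<forall>b\<in>set (dlist (dtl (dtl (foldl subtract_step (CONS n (CONS c out)) as)))). dsize b \<le> 3)"
  using assms
proof (induction as arbitrary: n c out)
  case (Cons a as)
  have "\<exists>n' c' b. subtract_step (CONS n (CONS c out)) a = CONS n' (CONS c' (CONS (enc_bool b) out))"
    unfolding subtract_step_def dhd.simps dtl.simps by (intro exI) (rule refl)
  then obtain n' c' b
    where step: "subtract_step (CONS n (CONS c out)) a = CONS n' (CONS c' (CONS (enc_bool b) out))"
    by blast
  have "\<forall>b\<in>set (dlist (CONS (enc_bool b) out)). dsize b \<le> 3"
    using Cons.prems by (simp add: enc_bool_def)
  from Cons.IH[OF this] show ?case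
    unfolding foldl.simps step by simp
qed simp

lemma subtract_data_bits:
  "length (dlist (dtl (dtl (subtract_data m n)))) = length (dlist m)"
  "b \<in> set (dlist (dtl (dtl (subtract_data m n)))) \<Longrightarrow> dsize b \<le> 3"
  using subtract_steps[of NIL n NIL "dlist m"] by (auto simp: subtract_data_def)

text \<open>A subtraction can turn many zero bits, of size 1, into one bits, of size 3, so the size
  of the remainder need not grow by a constant per step. Its length grows by at most one
  bit.\<close>

lemma polytime_divide_data:
  assumes "polytime f" and "polytime g"
  shows "polytime (\<lambda>x. divide_data (f x) (g x))"
proof (rule polytime_compose2[OF _ assms])
  have "polytime (\<lambda>p. foldl (divide_step (dtl p)) (CONS NIL NIL)
      (dlist (of_dlist (rev (dlist (dhd p))))))"
  proof (rule polytime_foldl[where b = "\<lambda>n. 8 * n + 3"])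
    show "polytime (\<lambda>p. divide_step (dtl (dhd p)) (dhd (dtl p)) (dtl (dtl p)))"
      unfolding divide_step_def Let_def
      by (intro polytime_intros polytime_subtract_data polytime_rev)
    fix x as bs assume as: "dlist (of_dlist (rev (dlist (dhd x)))) = as @ bs"
    define s where "s as = foldl (divide_step (dtl x)) (CONS NIL NIL) as" for as
    have inv: "length (dlist (dhd (s as))) \<le> length as \<and> (\<forall>b\<in>set (dlist (dhd (s as))). dsize b \<le> 3) \<and>
        dsize (dtl (s as)) \<le> 4 * length as + 1 \<and> (\<exists>u v. s as = CONS u v)"
    proof (induction as rule: rev_induct)
      case (snoc a as)
      have "s (as @ [a]) = divide_step (dtl x) (s as) a" by (simp add: s_def)
      with snoc show ?case
        by (auto simp: divide_step_def Let_def subtract_data_bits enc_bool_def)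
    qed (simp add: s_def)
    have "(\<Sum>b\<leftarrow>dlist (dhd (s as)). dsize b + 1) \<le> (\<Sum>b\<leftarrow>dlist (dhd (s as)). 4)"
      using inv by (intro sum_list_mono) auto
    then have "dsize (dhd (s as)) \<le> 4 * length as + 1"
      using inv dsize_of_dlist[of "dlist (dhd (s as))"] by (simp add: sum_list_triv)
    \<comment> \<open>A bit and its cell cost at most 4, so remainder and quotient have size at most
      \<open>4 * length as + 1\<close> each, and the pair needs one more cell.\<close>
    then have "dsize (s as) \<le> 8 * length as + 3"
      using inv by auto
    also have "length as \<le> dsize x"
      using arg_cong[OF as, of length] length_dlist[of "dhd x"] dsize_dhd[of x] by simp
    finally show "dsize (foldl (divide_step (dtl x)) (CONS NIL NIL) as) \<le> 8 * dsize x + 3"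
      by (simp add: s_def)
  qed (intro polytime_intros polytime_rev poly_bounded_intros)+
  from polytime_tl[OF this] show "polytime (\<lambda>p. divide_data (dhd p) (dtl p))"
    by (simp add: divide_data_def)
qed

section \<open>Correctness of subtraction and division on binary numbers\<close>

primrec bits_value :: "data list \<Rightarrow> nat" where
  "bits_value [] = 0"
| "bits_value (a # as) = of_bool (a \<noteq> NIL) + 2 * bits_value as"

lemma dtl_enc_nat: "dtl (enc_nat n) = enc_nat (n div 2)"
  by (simp add: enc_nat.simps[of n]) (simp add: enc_nat.simps)

lemma dhd_enc_nat: "dhd (enc_nat n) = enc_bool (odd n)"
  by (simp add: enc_nat.simps[of n] enc_bool_def)

lemma enc_bool_eq_NIL: "enc_bool b = NIL \<longleftrightarrow> \<not> b"
  by (simp add: enc_bool_def)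

lemma enc_nat_eq_NIL: "enc_nat n = NIL \<longleftrightarrow> n = 0"
  by (simp add: enc_nat.simps)

lemma enc_nat_0: "enc_nat 0 = NIL"
  by (simp add: enc_nat.simps)

lemma bits_value_enc_nat: "bits_value (dlist (enc_nat n)) = n"
proof (induction n rule: less_induct)
  case (less n)
  then show ?case
    by (cases "n = 0") (simp_all add: enc_nat_0 enc_nat.simps[of n] enc_bool_eq_NIL)
qed

lemma enc_nat_double: "enc_nat (2 * q) = (if enc_nat q = NIL then NIL else CONS NIL (enc_nat q))"
  by (simp add: enc_nat.simps[of "2 * q"] enc_nat_eq_NIL enc_bool_def)

lemma enc_nat_double_plus_1: "enc_nat (2 * q + 1) = CONS (enc_bool True) (enc_nat q)"
  by (subst enc_nat.simps) simp

lemma bits_value_less: "bits_value as < 2 ^ length as"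
  by (induction as) auto

text \<open>Borrowing invariant: the unread rest \<open>n'\<close> of the subtrahend and the final
  borrow are still owed at place value \<open>2 ^ length as\<close>. The equation is arranged
  without subtraction, to be valid for natural numbers.\<close>

lemma subtract_steps_correct:
  "\<exists>bs n' c'. foldl subtract_step (CONS (enc_nat n) (CONS (enc_bool c) out)) as =
      CONS (enc_nat n') (CONS (enc_bool c') (of_dlist (rev bs @ dlist out))) \<and>
    length bs = length as \<and>
    bits_value as + 2 ^ length as * (n' + of_bool c') = bits_value bs + n + of_bool c"
proof (induction as arbitrary: n c out)
  case Nil
  show ?case by (intro exI[of _ "[]"] exI[of _ n] exI[of _ c]) simp
next
  case (Cons a as)
  let ?c = "if a \<noteq> NIL then odd n \<and> c else odd n \<or> c"
  let ?b = "(a \<noteq> NIL) = (odd n = c)"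
  obtain bs n' c' where IH:
    "foldl subtract_step (CONS (enc_nat (n div 2)) (CONS (enc_bool ?c) (CONS (enc_bool ?b) out))) as =
      CONS (enc_nat n') (CONS (enc_bool c') (of_dlist (rev bs @ dlist (CONS (enc_bool ?b) out))))"
    "length bs = length as"
    "bits_value as + 2 ^ length as * (n' + of_bool c') = bits_value bs + n div 2 + of_bool ?c"
    using Cons.IH by blast
  have "subtract_step (CONS (enc_nat n) (CONS (enc_bool c) out)) a =
      CONS (enc_nat (n div 2)) (CONS (enc_bool ?c) (CONS (enc_bool ?b) out))"
    by (simp add: subtract_step_def dtl_enc_nat dhd_enc_nat enc_bool_eq_NIL)
  moreover have "bits_value (a # as) + 2 ^ length (a # as) * (n' + of_bool c') =
      bits_value (enc_bool ?b # bs) + n + of_bool c"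
  proof -
    \<comment> \<open>Naming the product \<open>P\<close> makes the remaining arithmetic
      linear.\<close>
    define P h where "P = 2 ^ length as * (n' + of_bool c')" and "h = n div 2"
    have P: "2 ^ length (a # as) * (n' + of_bool c') = 2 * P" by (simp add: P_def)
    have h: "n = (if odd n then 2 * h + 1 else 2 * h)" by (simp add: h_def)
    show ?thesis
      unfolding P bits_value.simps using IH(3)[folded P_def h_def] h
      by (cases "a = NIL"; cases "odd n"; cases c) (simp_all add: enc_bool_eq_NIL split del: if_split)
  qed
  ultimately show ?case
    using IH(1,2) by (intro exI[of _ "enc_bool ?b # bs"] exI[of _ n'] exI[of _ c']) simp
qed

lemma subtract_data_correct:
  obtains bs where
    "bits_value (dlist r) \<ge> d \<longleftrightarrow>
       dhd (subtract_data r (enc_nat d)) = NIL \<and> dhd (dtl (subtract_data r (enc_nat d))) = NIL"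
    "dtl (dtl (subtract_data r (enc_nat d))) = of_dlist (rev bs)"
    "bits_value (dlist r) \<ge> d \<Longrightarrow> bits_value bs = bits_value (dlist r) - d"
proof -
  obtain bs n c where *: "subtract_data r (enc_nat d) = CONS (enc_nat n) (CONS (enc_bool c) (of_dlist (rev bs)))"
    "length bs = length (dlist r)"
    "bits_value (dlist r) + 2 ^ length (dlist r) * (n + of_bool c) = bits_value bs + d"
    using subtract_steps_correct[of d False NIL "dlist r"]
    by (auto simp: subtract_data_def enc_bool_def)
  have less: "bits_value bs < 2 ^ length (dlist r)"
    using bits_value_less[of bs] *(2) by simp
  show ?thesis
  proof (cases "n = 0 \<and> \<not> c")
    case True
    with * show ?thesis by (intro that[of bs]) (auto simp: enc_nat_eq_NIL enc_bool_eq_NIL)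
  next
    case False
    \<comment> \<open>Anything still owed weighs at least \<open>2 ^ length (dlist r)\<close>, more
      than the difference bits can represent, so the true difference is negative.\<close>
    then have "2 ^ length (dlist r) * 1 \<le> 2 ^ length (dlist r) * (n + of_bool c)"
      by (intro mult_left_mono) auto
    then have "bits_value (dlist r) < d" using *(3) less by linarith
    with False * show ?thesis by (intro that[of bs]) (auto simp: enc_nat_eq_NIL enc_bool_eq_NIL)
  qed
qed

lemma divide_data_correct:
  assumes "d > 0"
  shows "divide_data (enc_nat n) (enc_nat d) = enc_nat (n div d)"
proof -
  \<comment> \<open>Generalised to arbitrary bit lists, for an induction that appends a new least
    significant bit. The quotient is determined as an encoding, the remainder only by its
    value.\<close>
  have "\<exists>r. foldr (\<lambda>a s. divide_step (enc_nat d) s a) as (CONS NIL NIL) =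
      CONS r (enc_nat (bits_value as div d)) \<and> bits_value (dlist r) = bits_value as mod d" for as
  proof (induction as)
    case Nil
    show ?case by (simp add: enc_nat.simps)
  next
    case (Cons a as)
    let ?N = "bits_value as"
    obtain r where r: "foldr (\<lambda>a s. divide_step (enc_nat d) s a) as (CONS NIL NIL) =
        CONS r (enc_nat (?N div d))" "bits_value (dlist r) = ?N mod d"
      using Cons.IH by blast
    let ?r = "CONS (enc_bool (a \<noteq> NIL)) r"
    have val: "bits_value (dlist ?r) = of_bool (a \<noteq> NIL) + 2 * (?N mod d)"
      by (simp add: r(2) enc_bool_eq_NIL)
    have "bits_value (a # as) = of_bool (a \<noteq> NIL) + 2 * (?N div d * d + ?N mod d)" by simp
    then have N: "bits_value (a # as) = 2 * (?N div d) * d + bits_value (dlist ?r)"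
      unfolding val by (simp only: algebra_simps)
    \<comment> \<open>The old remainder is below \<open>d\<close>, so at most one subtraction is due
      and the new quotient bit is 0 or 1.\<close>
    have small: "bits_value (dlist ?r) < 2 * d"
      using mod_less_divisor[OF assms, of ?N] unfolding val by (cases "a = NIL") simp_all
    obtain bs where bs:
      "bits_value (dlist ?r) \<ge> d \<longleftrightarrow>
         dhd (subtract_data ?r (enc_nat d)) = NIL \<and> dhd (dtl (subtract_data ?r (enc_nat d))) = NIL"
      "dtl (dtl (subtract_data ?r (enc_nat d))) = of_dlist (rev bs)"
      "bits_value (dlist ?r) \<ge> d \<Longrightarrow> bits_value bs = bits_value (dlist ?r) - d"
      using subtract_data_correct[where r = ?r] by blast
    have dm: "(m + k * d) div d = k" "(m + k * d) mod d = m" if "m < d" for m k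
      using that assms by simp_all
    show ?case
    proof (cases "bits_value (dlist ?r) \<ge> d")
      case True
      have eq: "bits_value (a # as) = (bits_value (dlist ?r) - d) + (2 * (?N div d) + 1) * d"
        using N True by (simp add: algebra_simps)
      have "bits_value (a # as) div d = 2 * (?N div d) + 1"
        "bits_value (a # as) mod d = bits_value (dlist ?r) - d"
        unfolding eq by (rule dm; use small True in linarith)+
      with True bs r(1) show ?thesis
        by (simp add: divide_step_def Let_def enc_nat_double_plus_1[simplified])
    next
      case False
      have eq: "bits_value (a # as) = bits_value (dlist ?r) + 2 * (?N div d) * d"
        using N by simp
      have "bits_value (a # as) div d = 2 * (?N div d)"
        "bits_value (a # as) mod d = bits_value (dlist ?r)"
        unfolding eq by (rule dm; use False in linarith)+
      with False bs r(1) show ?thesis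
        by (auto simp add: divide_step_def Let_def enc_nat_double)
    qed
  qed
  from this[of "dlist (enc_nat n)"] show ?thesis
    by (auto simp: divide_data_def foldl_conv_foldr bits_value_enc_nat)
qed

section \<open>Resilience and assignments into a dual\<close>

definition violations :: "('r, 'b) struct \<Rightarrow> (nat \<Rightarrow> 'b) \<Rightarrow> ('r \<times> nat list) list \<Rightarrow> nat" where
  "violations B a ts = length (filter (\<lambda>(R, xs). map a xs \<notin> interp B R) ts)"

definition preserves_exogenous ::
  "('r, 'b) struct \<Rightarrow> 'r set \<Rightarrow> (nat \<Rightarrow> 'b) \<Rightarrow> ('r \<times> nat list) list \<Rightarrow> bool" where
  "preserves_exogenous B \<sigma> a ts \<longleftrightarrow> (\<forall>(R, xs)\<in>set ts. R \<in> \<sigma> \<longrightarrow> map a xs \<in> interp B R)"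

lemma in_bagdb_of: "xs \<in># bag_interp (bagdb_of ds ts) R \<longleftrightarrow> (R, xs) \<in> set ts"
  by (force simp: bagdb_of_def)

text \<open>Links a count over one list of tuples, as in \<open>violations\<close>, with the sum
  over relation symbols that measures deletions.\<close>

lemma length_eq_sum_fst:
  assumes "finite T" and "fst ` set ts \<subseteq> T"
  shows "length ts = (\<Sum>R\<in>T. length (filter (\<lambda>t. fst t = R) ts))"
  using assms(2)
proof (induction ts)
  case (Cons t ts)
  have "(\<Sum>R\<in>T. length (filter (\<lambda>s. fst s = R) (t # ts))) =
      (\<Sum>R\<in>T. of_bool (R = fst t) + length (filter (\<lambda>s. fst s = R) ts))"
    by (intro sum.cong) auto
  with Cons assms(1) show ?case
    by (simp add: sum.distrib of_bool_def sum.delta)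
qed simp

lemma resilience_le_iff_assignment:
  fixes B :: "(nat, 'b) struct"
  assumes fin: "finite \<tau>" and dual: "is_dual \<tau> ar \<mu> B"
    and ts: "fst ` set ts \<subseteq> \<tau>" and db: "is_bagdb \<tau> ar (bagdb_of ds ts)"
  shows "resilience_le \<tau> \<sigma> \<mu> (bagdb_of ds ts) u \<longleftrightarrow>
    (\<exists>a. a ` set ds \<subseteq> univ B \<and> preserves_exogenous B \<sigma> a ts \<and> violations B a ts \<le> u)"
    (is "?L \<longleftrightarrow> ?R")
proof -
  let ?A = "bagdb_of ds ts"
  let ?rest = "\<lambda>D. struct_of_bagdb (remove_tuples ?A D)"
  have hom_iff: "(\<exists>h. is_hom \<tau> h (?rest D) B) \<longleftrightarrow> \<not> models_ucq (?rest D) \<mu>" for D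
  proof -
    have "is_struct \<tau> ar (?rest D) \<and> finite (univ (?rest D))"
      using db by (force simp: is_bagdb_def is_struct_def struct_of_bagdb_def remove_tuples_def
          dest: in_diffD)
    then show ?thesis using dual unfolding is_dual_def by blast
  qed
  let ?bad = "\<lambda>a R. mset (map snd (filter (\<lambda>t. fst t = R) (filter (\<lambda>(R, xs). map a xs \<notin> interp B R) ts)))"
  have bad: "?bad a R = filter_mset (\<lambda>xs. map a xs \<notin> interp B R) (bag_interp ?A R)" for a :: "nat \<Rightarrow> 'b" and R
  proof -
    have eq: "map snd (filter (\<lambda>t. fst t = R) (filter (\<lambda>(R, xs). map a xs \<notin> interp B R) ts)) =
        filter (\<lambda>xs. map a xs \<notin> interp B R) (map snd (filter (\<lambda>t. fst t = R) ts))"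
      by (induction ts) (auto simp del: filter_filter)
    show ?thesis unfolding eq bagdb_of_def by (simp only: bagdb.select_convs mset_filter)
  qed
  \<comment> \<open>All exogenous tuples are satisfied, so every violated tuple lies in a relation
    from which tuples may be removed.\<close>
  have viol: "violations B a ts = (\<Sum>R\<in>\<tau> - \<sigma>. size (?bad a R))" if "preserves_exogenous B \<sigma> a ts" for a
  proof -
    have "fst ` set (filter (\<lambda>(R, xs). map a xs \<notin> interp B R) ts) \<subseteq> \<tau> - \<sigma>"
      using ts that by (auto simp: preserves_exogenous_def)
    from length_eq_sum_fst[OF _ this] fin show ?thesis
      by (simp only: violations_def size_mset length_map finite_Diff)
  qed
  show ?thesis
  proof
    assume ?L
    then obtain D where D: "\<forall>R\<in>\<tau> - \<sigma>. D R \<subseteq># bag_interp ?A R" "\<forall>R. R \<notin> \<tau> - \<sigma> \<longrightarrow> D R = {#}"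
      "(\<Sum>R\<in>\<tau> - \<sigma>. size (D R)) \<le> u" "\<not> models_ucq (?rest D) \<mu>"
      unfolding resilience_le_def by blast
    then obtain a where a: "is_hom \<tau> a (?rest D) B"
      using hom_iff by blast
    have hom: "map a xs \<in> interp B R" if "xs \<in># bag_interp ?A R - D R" "R \<in> \<tau>" for R xs
      using a that by (auto simp: is_hom_def struct_of_bagdb_def remove_tuples_def)
    have exo: "preserves_exogenous B \<sigma> a ts"
      unfolding preserves_exogenous_def
    proof (intro ballI, clarify)
      fix R xs assume "(R, xs) \<in> set ts" "R \<in> \<sigma>"
      then show "map a xs \<in> interp B R"
        using hom[of xs R] D(2) ts by (force simp: in_bagdb_of)
    qed
    \<comment> \<open>If one copy of a violated tuple survived, \<open>a\<close> would not be a
      homomorphism; hence \<open>D\<close> contains all its copies.\<close>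
    have "?bad a R \<subseteq># D R" if "R \<in> \<tau> - \<sigma>" for R
    proof (rule mset_subset_eqI)
      fix xs
      show "count (?bad a R) xs \<le> count (D R) xs"
        using hom[of xs R] that unfolding bad by (fastforce simp: in_diff_count not_le)
    qed
    then have "(\<Sum>R\<in>\<tau> - \<sigma>. size (?bad a R)) \<le> (\<Sum>R\<in>\<tau> - \<sigma>. size (D R))"
      by (intro sum_mono size_mset_mono)
    with D(3) viol[OF exo] have "violations B a ts \<le> u" by simp
    moreover have "a ` set ds \<subseteq> univ B"
      using a by (simp add: is_hom_def struct_of_bagdb_def remove_tuples_def bagdb_of_def)
    ultimately show ?R using exo by blast
  next
    assume ?R
    then obtain a where a: "a ` set ds \<subseteq> univ B" "preserves_exogenous B \<sigma> a ts" "violations B a ts \<le> u"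
      by blast
    define D where "D R = (if R \<in> \<tau> - \<sigma> then ?bad a R else {#})" for R
    have "is_hom \<tau> a (?rest D) B"
      unfolding is_hom_def
    proof (intro conjI ballI)
      show "a ` univ (?rest D) \<subseteq> univ B"
        using a(1) by (simp add: struct_of_bagdb_def remove_tuples_def bagdb_of_def)
      fix R xs assume R: "R \<in> \<tau>" and xs: "xs \<in> interp (?rest D) R"
      from xs have in_diff: "xs \<in># bag_interp ?A R - D R"
        by (simp add: struct_of_bagdb_def remove_tuples_def)
      show "map a xs \<in> interp B R"
      proof (cases "R \<in> \<sigma>")
        case True
        with in_diff a(2) show ?thesis
          by (auto simp: preserves_exogenous_def in_bagdb_of dest!: in_diffD)
      next
        case False
        with in_diff R show ?thesis
          unfolding D_def bad by (auto simp: in_diff_count split: if_splits)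
      qed
    qed
    then have "\<not> models_ucq (?rest D) \<mu>" using hom_iff by blast
    moreover have "(\<Sum>R\<in>\<tau> - \<sigma>. size (D R)) \<le> u"
      using a(3) unfolding viol[OF a(2)] D_def by simp
    moreover have "\<forall>R\<in>\<tau> - \<sigma>. D R \<subseteq># bag_interp ?A R"
      unfolding D_def bad by simp
    ultimately show ?L
      unfolding resilience_le_def by (intro exI[of _ D]) (auto simp: D_def)
  qed
qed


section \<open>The cost of an expression\<close>

fun relation_tuples :: "'r atom list \<Rightarrow> ('r \<times> nat list) list" where
  "relation_tuples [] = []"
| "relation_tuples (Rel R xs # \<phi>) = (R, xs) # relation_tuples \<phi>"
| "relation_tuples (REq x y # \<phi>) = relation_tuples \<phi>"
| "relation_tuples (REmpty x # \<phi>) = relation_tuples \<phi>"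

lemma in_relation_tuples: "(R, xs) \<in> set (relation_tuples \<phi>) \<longleftrightarrow> Rel R xs \<in> set \<phi>"
  by (induction \<phi> rule: relation_tuples.induct) auto

lemma relation_tuples_map_Rel: "relation_tuples (map (\<lambda>(R, xs). Rel R xs) ts) = ts"
  by (induction ts) auto

definition preserves_equations :: "'r atom list \<Rightarrow> (nat \<Rightarrow> 'b) \<Rightarrow> bool" where
  "preserves_equations \<phi> a \<longleftrightarrow> (\<forall>x y. REq x y \<in> set \<phi> \<longrightarrow> a x = a y)"

lemma expression_cost_Gamma:
  "expression_cost (Gamma B \<sigma>) \<phi> a =
     (if (\<forall>x. REmpty x \<notin> set \<phi>) \<and> preserves_equations \<phi> a \<and>
         preserves_exogenous B \<sigma> a (relation_tuples \<phi>)
      then Fin (of_nat (violations B a (relation_tuples \<phi>))) else Infty)"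
proof (induction \<phi>)
  case Nil
  show ?case
    by (simp add: expression_cost_def preserves_equations_def preserves_exogenous_def violations_def
        zero_cost_def)
next
  case (Cons \<alpha> \<phi>)
  have "expression_cost (Gamma B \<sigma>) (\<alpha> # \<phi>) a =
      atom_cost (Gamma B \<sigma>) a \<alpha> + expression_cost (Gamma B \<sigma>) \<phi> a"
    by (simp add: expression_cost_def)
  also note Cons.IH
  finally have IH: "expression_cost (Gamma B \<sigma>) (\<alpha> # \<phi>) a = atom_cost (Gamma B \<sigma>) a \<alpha> +
     (if (\<forall>x. REmpty x \<notin> set \<phi>) \<and> preserves_equations \<phi> a \<and>
         preserves_exogenous B \<sigma> a (relation_tuples \<phi>)
      then Fin (of_nat (violations B a (relation_tuples \<phi>))) else Infty)" .
  have add_Infty: "c + Infty = Infty" for c by (cases c) auto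
  show ?case
  proof (cases \<alpha>)
    case (Rel R xs)
    have "preserves_equations (\<alpha> # \<phi>) a = preserves_equations \<phi> a"
      by (simp add: Rel preserves_equations_def)
    then show ?thesis
      unfolding IH using Rel
      by (auto simp: add_Infty Gamma_def preserves_exogenous_def violations_def zero_cost_def)
  next
    case (REq x y)
    have "preserves_equations (\<alpha> # \<phi>) a = (a x = a y \<and> preserves_equations \<phi> a)"
      by (auto simp: REq preserves_equations_def)
    then show ?thesis
      unfolding IH using REq by (auto simp: zero_cost_def)
  next
    case (REmpty x)
    then show ?thesis unfolding IH by auto
  qed
qed

text \<open>A finite cost is a natural number, so a rational threshold may be rounded down. Since
  \<open>nat\<close> sends negative integers to 0, negative thresholds have to be excluded
  explicitly.\<close>

lemma expression_cost_le_iff: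
  "expression_cost (Gamma B \<sigma>) \<phi> a \<le> Fin u \<longleftrightarrow>
     (\<forall>x. REmpty x \<notin> set \<phi>) \<and> u \<ge> 0 \<and> preserves_equations \<phi> a \<and>
     preserves_exogenous B \<sigma> a (relation_tuples \<phi>) \<and>
     violations B a (relation_tuples \<phi>) \<le> nat \<lfloor>u\<rfloor>"
proof -
  have "of_nat n \<le> u \<longleftrightarrow> u \<ge> 0 \<and> n \<le> nat \<lfloor>u\<rfloor>" for n
  proof (cases "u \<ge> 0")
    case True
    have "of_nat n \<le> u \<longleftrightarrow> int n \<le> \<lfloor>u\<rfloor>" by (simp add: le_floor_iff)
    with True show ?thesis by (simp add: le_nat_iff)
  next
    case False
    then have "\<not> of_nat n \<le> u" using of_nat_0_le_iff[of n, where 'a = rat] by linarith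
    with False show ?thesis by simp
  qed
  then show ?thesis
    unfolding expression_cost_Gamma by auto
qed


section \<open>Reductions\<close>

lemma enc_rat_of_nat: "enc_rat (of_nat n) = CONS (CONS NIL (enc_nat n)) (enc_nat 1)"
  using quotient_of_int[of "int n"] by (simp add: enc_rat_def enc_int_def enc_bool_def)

lemma resilience_reducible_VCSP:
  fixes B :: "(nat, 'b) struct"
  assumes "finite \<tau>" and "is_dual \<tau> ar \<mu> B"
  shows "polytime_reducible (resilience_problem \<tau> ar \<sigma> \<mu>) (VCSP \<tau> ar (Gamma B \<sigma>))"
proof -
  define f :: "resilience_inst \<Rightarrow> vcsp_inst"
    where "f = (\<lambda>(ds, ts, u). (ds, map (\<lambda>(R, xs). Rel R xs) ts, of_nat u))"
  \<comment> \<open>\<open>CONS NIL\<close> prefixes a tuple with the tag \<open>enc_nat 0\<close>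
    of \<open>Rel\<close>; the bound becomes a rational with sign bit \<open>NIL\<close> and
    denominator 1.\<close>
  define g where "g x = CONS (dhd x) (CONS (of_dlist (map (CONS NIL) (dlist (dhd (dtl x)))))
    (CONS (CONS NIL (dtl (dtl x))) (enc_nat 1)))" for x
  have "polytime g"
    unfolding g_def by (intro polytime_intros)
  moreover have "f x \<in> instances (VCSP \<tau> ar (Gamma B \<sigma>)) \<and>
      g (encoding (resilience_problem \<tau> ar \<sigma> \<mu>) x) = encoding (VCSP \<tau> ar (Gamma B \<sigma>)) (f x) \<and>
      (x \<in> yes_instances (resilience_problem \<tau> ar \<sigma> \<mu>) \<longleftrightarrow>
        f x \<in> yes_instances (VCSP \<tau> ar (Gamma B \<sigma>)))"
    if "x \<in> instances (resilience_problem \<tau> ar \<sigma> \<mu>)" for x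
  proof -
    obtain ds ts u where x: "x = (ds, ts, u)" by (cases x)
    with that have inst: "distinct ds" "fst ` set ts \<subseteq> \<tau>" "is_bagdb \<tau> ar (bagdb_of ds ts)"
      by (auto simp: resilience_problem_def)
    let ?\<phi> = "map (\<lambda>(R, xs). Rel R xs) ts"
    have "\<forall>\<alpha>\<in>set ?\<phi>. is_atom \<tau> ar (set ds) \<alpha>"
    proof (clarsimp)
      fix R xs assume Rxs: "(R, xs) \<in> set ts"
      with inst(2) have R: "R \<in> \<tau>" by force
      have "xs \<in># bag_interp (bagdb_of ds ts) R" using Rxs by (simp add: in_bagdb_of)
      with inst(3) R have "xs \<in> tuples_over (ar R) (set ds)"
        by (auto simp: is_bagdb_def is_struct_def struct_of_bagdb_def bagdb_of_def)
      with R show "R \<in> \<tau> \<and> xs \<in> tuples_over (ar R) (set ds)" by blast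
    qed
    then have f_inst: "f x \<in> instances (VCSP \<tau> ar (Gamma B \<sigma>))"
      using inst by (simp add: x f_def VCSP_def)
    have "g (enc_resilience x) = enc_vcsp (f x)"
    proof -
      have "enc_list enc_atom ?\<phi> =
          of_dlist (map (CONS NIL \<circ> (\<lambda>(R, xs). CONS (enc_nat R) (enc_list enc_nat xs))) ts)"
        by (induction ts) (auto simp: enc_nat_0)
      then show ?thesis
        by (simp add: x f_def g_def enc_resilience_def enc_vcsp_def enc_rat_of_nat)
    qed
    moreover have "resilience_le \<tau> \<sigma> \<mu> (bagdb_of ds ts) u \<longleftrightarrow>
        (\<exists>a. (\<forall>x\<in>set ds. a x \<in> univ B) \<and> expression_cost (Gamma B \<sigma>) ?\<phi> a \<le> Fin (of_nat u))"
    proof -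
      have "REmpty x \<notin> set ?\<phi>" "preserves_equations ?\<phi> a" for x and a :: "nat \<Rightarrow> 'b"
        by (auto simp: preserves_equations_def)
      then show ?thesis
        unfolding resilience_le_iff_assignment[OF assms inst(2,3)] expression_cost_le_iff
          relation_tuples_map_Rel by (simp add: image_subset_iff)
    qed
    ultimately show ?thesis
      using f_inst that by (auto simp: x f_def resilience_problem_def VCSP_def Gamma_def)
  qed
  ultimately show ?thesis
    unfolding polytime_reducible_def using polytime_computable_on by blast
qed

text \<open>The witness is the canonical database of a query in \<open>\<mu>\<close> with bound 0:
  nothing can be removed, and the identity satisfies the query.\<close>

lemma resilience_no_instance:
  assumes "finite \<tau>" and "is_ucq \<tau> ar \<mu>"
  obtains x where "x \<in> instances (resilience_problem \<tau> ar \<sigma> \<mu>)"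
    and "x \<notin> yes_instances (resilience_problem \<tau> ar \<sigma> \<mu>)"
proof -
  obtain q where q: "q \<in> set \<mu>" "is_cq \<tau> ar q"
    using assms(2) unfolding is_ucq_def by (metis ex_in_conv set_empty)
  obtain ds where ds: "set ds = vars q" "distinct ds"
    using q(2) finite_distinct_list[of "vars q"] by (auto simp: is_cq_def)
  obtain ts where ts: "set ts = conjuncts q"
    using q(2) finite_list[of "conjuncts q"] by (auto simp: is_cq_def)
  have "fst ` set ts \<subseteq> \<tau>" "is_bagdb \<tau> ar (bagdb_of ds ts)"
  proof -
    show "fst ` set ts \<subseteq> \<tau>" using q(2) by (auto simp: ts is_cq_def)
    have "xs \<in> tuples_over (ar R) (vars q)" if "xs \<in># bag_interp (bagdb_of ds ts) R" for R xs
      using that q(2) unfolding in_bagdb_of ts is_cq_def by blast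
    then show "is_bagdb \<tau> ar (bagdb_of ds ts)"
      unfolding is_bagdb_def is_struct_def struct_of_bagdb_def
      by (auto simp: ds(1)[symmetric]) (simp_all add: bagdb_of_def)
  qed
  with ds(2) have "(ds, ts, 0) \<in> instances (resilience_problem \<tau> ar \<sigma> \<mu>)"
    by (simp add: resilience_problem_def)
  moreover have "\<not> resilience_le \<tau> \<sigma> \<mu> (bagdb_of ds ts) 0"
  proof
    assume "resilience_le \<tau> \<sigma> \<mu> (bagdb_of ds ts) 0"
    then obtain D where D: "\<forall>R. R \<notin> \<tau> - \<sigma> \<longrightarrow> D R = {#}" "(\<Sum>R\<in>\<tau> - \<sigma>. size (D R)) = 0"
      "\<not> models_ucq (struct_of_bagdb (remove_tuples (bagdb_of ds ts) D)) \<mu>"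
      unfolding resilience_le_def by auto
    from D(1,2) assms(1) have "D R = {#}" for R by auto
    then have "cq_assignment q (struct_of_bagdb (remove_tuples (bagdb_of ds ts) D)) (\<lambda>x. x)"
      by (auto simp: cq_assignment_def struct_of_bagdb_def remove_tuples_def in_bagdb_of ts)
        (simp add: bagdb_of_def ds)
    with D(3) q(1) show False unfolding models_ucq_def by blast
  qed
  ultimately show ?thesis
    by (intro that[of "(ds, ts, 0)"]) (auto simp: resilience_problem_def)
qed

lemma VCSP_reducible_resilience:
  fixes B :: "(nat, 'b) struct"
  assumes "finite \<tau>" and "is_ucq \<tau> ar \<mu>" and "is_dual \<tau> ar \<mu> B"
  shows "polytime_reducible (VCSP \<tau> ar (Gamma B \<sigma>)) (resilience_problem \<tau> ar \<sigma> \<mu>)"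
proof -
  obtain no where no: "no \<in> instances (resilience_problem \<tau> ar \<sigma> \<mu>)"
    "no \<notin> yes_instances (resilience_problem \<tau> ar \<sigma> \<mu>)"
    using resilience_no_instance[OF assms(1,2)] by blast
  define f :: "vcsp_inst \<Rightarrow> resilience_inst" where
    "f = (\<lambda>(xs, \<phi>, u). let \<rho> = subst (solve_equations \<phi>) in
       if u < 0 \<or> (\<exists>x. REmpty x \<in> set \<phi>) then no
       else (filter (\<lambda>z. \<rho> z = z) xs, map (\<lambda>(R, ys). (R, map \<rho> ys)) (relation_tuples \<phi>), nat \<lfloor>u\<rfloor>))"
  \<comment> \<open>The first test reads the sign of the threshold, the second looks for the tag 2
    of \<open>REmpty\<close>. Comparing a tag with \<open>NIL\<close> selects the atoms
    \<open>Rel\<close>, whose tag is 0.\<close>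
  define g where "g x =
    (if dhd (dhd (dtl (dtl x))) \<noteq> NIL \<or>
        of_dlist (filter (\<lambda>\<alpha>. dhd \<alpha> = enc_nat 2) (dlist (dhd (dtl x)))) \<noteq> NIL
     then enc_resilience no
     else CONS (of_dlist (filter (\<lambda>z. subst_data (solve_data (dhd (dtl x))) z = z) (dlist (dhd x))))
       (CONS (of_dlist (map (\<lambda>\<alpha>. CONS (dhd (dtl \<alpha>))
           (of_dlist (map (subst_data (solve_data (dhd (dtl x)))) (dlist (dtl (dtl \<alpha>))))))
           (filter (\<lambda>\<alpha>. dhd \<alpha> = NIL) (dlist (dhd (dtl x))))))
         (divide_data (dtl (dhd (dtl (dtl x)))) (dtl (dtl (dtl x))))))" for x
  have "polytime g"
    unfolding g_def
    by (intro polytime_intros polytime_subst_data polytime_solve_data polytime_divide_data)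
  moreover have "f x \<in> instances (resilience_problem \<tau> ar \<sigma> \<mu>) \<and>
      g (encoding (VCSP \<tau> ar (Gamma B \<sigma>)) x) = encoding (resilience_problem \<tau> ar \<sigma> \<mu>) (f x) \<and>
      (x \<in> yes_instances (VCSP \<tau> ar (Gamma B \<sigma>)) \<longleftrightarrow>
        f x \<in> yes_instances (resilience_problem \<tau> ar \<sigma> \<mu>))"
    if "x \<in> instances (VCSP \<tau> ar (Gamma B \<sigma>))" for x
  proof -
    obtain xs \<phi> u where x: "x = (xs, \<phi>, u)" by (cases x)
    with that have inst: "distinct xs" "\<forall>\<alpha>\<in>set \<phi>. is_atom \<tau> ar (set xs) \<alpha>"
      by (auto simp: VCSP_def)
    define \<rho> where "\<rho> = subst (solve_equations \<phi>)"
    define ds where "ds = filter (\<lambda>z. \<rho> z = z) xs"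
    define ts where "ts = map (\<lambda>(R, ys). (R, map \<rho> ys)) (relation_tuples \<phi>)"
    have f_x: "f x = (if u < 0 \<or> (\<exists>x. REmpty x \<in> set \<phi>) then no else (ds, ts, nat \<lfloor>u\<rfloor>))"
      by (simp add: x f_def ds_def ts_def \<rho>_def Let_def)
    have \<rho>_in: "\<rho> z \<in> set ds" if "z \<in> set xs" for z
      using subst_in[OF inst(2) that] subst_idem by (simp add: ds_def \<rho>_def)
    have ts_\<tau>: "fst ` set ts \<subseteq> \<tau>"
      using inst(2) by (auto simp: ts_def in_relation_tuples dest!: bspec)
    have "ys \<in> tuples_over (ar R) (set ds)" if "(R, ys) \<in> set ts" for R ys
    proof -
      obtain zs where zs: "Rel R zs \<in> set \<phi>" "ys = map \<rho> zs"
        using \<open>(R, ys) \<in> set ts\<close> by (auto simp: ts_def in_relation_tuples)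
      then have "zs \<in> tuples_over (ar R) (set xs)" using inst(2) by fastforce
      then show ?thesis using \<rho>_in zs(2) by (auto simp: tuples_over_def)
    qed
    then have db: "is_bagdb \<tau> ar (bagdb_of ds ts)"
      unfolding is_bagdb_def is_struct_def struct_of_bagdb_def
      by (auto simp: in_bagdb_of) (simp_all add: bagdb_of_def)
    have f_inst: "f x \<in> instances (resilience_problem \<tau> ar \<sigma> \<mu>)"
      using no ts_\<tau> db inst(1) by (simp add: f_x resilience_problem_def ds_def)
    have yes: "(\<exists>a. (\<forall>z\<in>set xs. a z \<in> univ B) \<and> expression_cost (Gamma B \<sigma>) \<phi> a \<le> Fin u) \<longleftrightarrow>
        resilience_le \<tau> \<sigma> \<mu> (bagdb_of ds ts) (nat \<lfloor>u\<rfloor>)"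
      if "u \<ge> 0" "\<forall>x. REmpty x \<notin> set \<phi>"
    proof -
      \<comment> \<open>Substituting in the tuples amounts to composing the assignment with
        \<open>\<rho>\<close>, so both sides can be compared on the original tuples.\<close>
      have contract: "preserves_exogenous B \<sigma> a ts = preserves_exogenous B \<sigma> (a \<circ> \<rho>) (relation_tuples \<phi>)"
        "violations B a ts = violations B (a \<circ> \<rho>) (relation_tuples \<phi>)" for a
        by (auto simp: preserves_exogenous_def violations_def ts_def filter_map o_def case_prod_unfold)
      show ?thesis
        unfolding resilience_le_iff_assignment[OF assms(1,3) ts_\<tau> db] expression_cost_le_iff contract
      proof safe
        fix a :: "nat \<Rightarrow> 'b"
        assume a: "\<forall>z\<in>set xs. a z \<in> univ B" "preserves_equations \<phi> a"
          "preserves_exogenous B \<sigma> a (relation_tuples \<phi>)" "violations B a (relation_tuples \<phi>) \<le> nat \<lfloor>u\<rfloor>"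
        have "a \<circ> \<rho> = a"
          using subst_most_general[of \<phi> a] a(2) by (auto simp: preserves_equations_def \<rho>_def)
        with a show "\<exists>a. a ` set ds \<subseteq> univ B \<and> preserves_exogenous B \<sigma> (a \<circ> \<rho>) (relation_tuples \<phi>) \<and>
            violations B (a \<circ> \<rho>) (relation_tuples \<phi>) \<le> nat \<lfloor>u\<rfloor>"
          by (intro exI[of _ a]) (auto simp: ds_def)
      next
        fix a :: "nat \<Rightarrow> 'b"
        assume a: "a ` set ds \<subseteq> univ B" "preserves_exogenous B \<sigma> (a \<circ> \<rho>) (relation_tuples \<phi>)"
          "violations B (a \<circ> \<rho>) (relation_tuples \<phi>) \<le> nat \<lfloor>u\<rfloor>"
        \<comment> \<open>Composition with \<open>\<rho>\<close> extends an assignment of the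
          representatives to all variables and makes the equations true.\<close>
        have "preserves_equations \<phi> (a \<circ> \<rho>)"
          using subst_solves[of _ _ \<phi>] by (auto simp: preserves_equations_def \<rho>_def)
        with a that \<rho>_in show "\<exists>a. (\<forall>z\<in>set xs. a z \<in> univ B) \<and> (\<forall>x. REmpty x \<notin> set \<phi>) \<and> 0 \<le> u \<and>
            preserves_equations \<phi> a \<and> preserves_exogenous B \<sigma> a (relation_tuples \<phi>) \<and>
            violations B a (relation_tuples \<phi>) \<le> nat \<lfloor>u\<rfloor>"
          by (intro exI[of _ "a \<circ> \<rho>"]) auto
      qed
    qed
    have "x \<in> yes_instances (VCSP \<tau> ar (Gamma B \<sigma>)) \<longleftrightarrow>
        f x \<in> yes_instances (resilience_problem \<tau> ar \<sigma> \<mu>)"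
    proof (cases "u < 0 \<or> (\<exists>x. REmpty x \<in> set \<phi>)")
      case True
      then have "\<not> expression_cost (Gamma B \<sigma>) \<phi> a \<le> Fin u" for a
        unfolding expression_cost_le_iff by auto
      with True no(2) show ?thesis by (simp add: x f_x[unfolded x] VCSP_def)
    next
      case False
      with yes f_inst that show ?thesis
        by (simp add: x f_x[unfolded x] VCSP_def resilience_problem_def Gamma_def not_less)
    qed
    moreover have "g (enc_vcsp x) = enc_resilience (f x)"
    proof -
      obtain n d where nd: "quotient_of u = (n, d)" by (cases "quotient_of u")
      have d: "d > 0" and u: "u = Fract n d"
        using quotient_of_denom_pos[OF nd] quotient_of_div[OF nd] by (simp_all add: Fract_of_int_quotient)
      have neg: "u < 0 \<longleftrightarrow> n < 0"
        using d by (simp add: u Fract_less_zero_iff)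
      have floor: "nat \<lfloor>u\<rfloor> = nat n div nat d" if "\<not> n < 0"
        using that d by (simp add: u floor_Fract nat_div_distrib)
      have empty: "of_dlist (filter (\<lambda>\<alpha>. dhd \<alpha> = enc_nat 2) (map enc_atom \<phi>)) \<noteq> NIL \<longleftrightarrow>
          (\<exists>x. REmpty x \<in> set \<phi>)"
      proof -
        have "(of_dlist ys \<noteq> NIL) = (ys \<noteq> [])" for ys by (cases ys) auto
        moreover have "dhd (enc_atom \<alpha>) = enc_nat 2 \<longleftrightarrow> (\<exists>x. \<alpha> = REmpty x)" for \<alpha>
          by (cases \<alpha>) auto
        ultimately show ?thesis by (auto simp: filter_empty_conv)
      qed
      have subst: "subst_data (solve_data (enc_list enc_atom \<phi>)) (enc_nat z) = enc_nat (\<rho> z)" for z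
        by (simp add: solve_data_enc subst_data_enc \<rho>_def)
      have "map (\<lambda>\<alpha>. CONS (dhd (dtl \<alpha>))
            (of_dlist (map (subst_data (solve_data (enc_list enc_atom \<phi>))) (dlist (dtl (dtl \<alpha>))))))
          (filter (\<lambda>\<alpha>. dhd \<alpha> = NIL) (map enc_atom \<psi>)) =
        map (\<lambda>(R, ys). CONS (enc_nat R) (enc_list enc_nat (map \<rho> ys))) (relation_tuples \<psi>)" for \<psi>
        by (induction \<psi> rule: relation_tuples.induct)
          (simp_all add: enc_nat_eq_NIL subst enc_list_conv[of enc_nat] o_def)
      moreover have "filter (\<lambda>z. subst_data (solve_data (enc_list enc_atom \<phi>)) z = z) (map enc_nat xs) =
          map enc_nat ds"
        by (simp add: filter_map o_def subst ds_def)
      moreover have "divide_data (enc_nat (nat \<bar>n\<bar>)) (enc_nat (nat d)) = enc_nat (nat n div nat d)"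
        if "\<not> n < 0"
        using that d by (simp add: divide_data_correct)
      ultimately show ?thesis
        using empty neg floor
        by (auto simp: x f_x[unfolded x] g_def enc_vcsp_def enc_resilience_def enc_rat_def enc_int_def nd
            enc_bool_eq_NIL ts_def case_prod_unfold o_def enc_list_conv[of enc_nat ds]
            enc_list_conv[of "\<lambda>t. CONS (enc_nat (fst t)) (enc_list enc_nat (snd t))"])
    qed
    ultimately show ?thesis
      using f_inst by (simp add: VCSP_def resilience_problem_def)
  qed
  ultimately show ?thesis
    unfolding polytime_reducible_def using polytime_computable_on by blast
qed

lemma resilience_equivalent_VCSP:
  assumes "finite \<tau>" and "is_ucq \<tau> ar \<mu>" and "is_dual \<tau> ar \<mu> B"
  shows "polytime_equivalent (resilience_problem \<tau> ar \<sigma> \<mu>) (VCSP \<tau> ar (Gamma B \<sigma>))"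
  using resilience_reducible_VCSP[OF assms(1,3)] VCSP_reducible_resilience[OF assms]
  unfolding polytime_equivalent_def by blast

section \<open>Duality of the structure of Cherlin, Shelah and Shi\<close>

lemma models_ucq_hom:
  assumes "is_ucq \<tau> ar \<mu>" and "is_hom \<tau> h A B" and "models_ucq A \<mu>"
  shows "models_ucq B \<mu>"
proof -
  obtain q k where q: "q \<in> set \<mu>" "is_cq \<tau> ar q" "cq_assignment q A k"
    using assms(1,3) unfolding models_ucq_def is_ucq_def by blast
  have "cq_assignment q B (h \<circ> k)"
    using assms(2) q(2,3) unfolding cq_assignment_def is_hom_def is_cq_def
    by (fastforce simp flip: map_map)
  with q(1) show ?thesis unfolding models_ucq_def by blast
qed

lemma embedding_is_hom:
  "is_embedding \<tau> ar h A B \<Longrightarrow> is_struct \<tau> ar A \<Longrightarrow> is_hom \<tau> h A B"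
  unfolding is_embedding_def is_struct_def is_hom_def by blast

text \<open>
  Since the embedding property only concerns structures on natural numbers, it is applied to an
  isomorphic copy of \<open>B\<close> itself to see that \<open>B\<close> does not satisfy \<open>\<mu>\<close>.
\<close>

lemma is_CSS_structure_imp_dual:
  fixes B :: "('r, 'b) struct"
  assumes ucq: "is_ucq \<tau> ar \<mu>" and css: "is_CSS_structure \<tau> ar \<mu> B"
  shows "is_dual \<tau> ar \<mu> B"
proof -
  have B: "is_struct \<tau> ar B" "countable (univ B)"
    and embeds: "\<And>A :: ('r, nat) struct. is_struct \<tau> ar A \<Longrightarrow> \<not> models_ucq A \<mu> \<longleftrightarrow> embeds \<tau> ar A B"
    using css unfolding is_CSS_structure_def by blast+
  \<comment> \<open>\<open>i\<close> numbers the elements of \<open>B\<close>, \<open>j\<close>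
    inverts it on the domain, and \<open>N\<close> is the copy of \<open>B\<close> on these
    numbers.\<close>
  define i where "i = to_nat_on (univ B)"
  define j where "j = from_nat_into (univ B)"
  have ji: "j (i b) = b" if "b \<in> univ B" for b
    using that B(2) by (simp add: i_def j_def)
  define N :: "('r, nat) struct" where "N = \<lparr>univ = i ` univ B, interp = (\<lambda>R. map i ` interp B R)\<rparr>"
  have N: "is_struct \<tau> ar N"
    using B(1) unfolding is_struct_def tuples_over_def N_def by fastforce
  have tuple: "map j (map i xs) = xs" if "set xs \<subseteq> univ B" for xs
    using that ji by (induction xs) auto
  have "is_embedding \<tau> ar j N B"
    unfolding is_embedding_def
  proof (intro conjI ballI)
    show "j ` univ N \<subseteq> univ B" "inj_on j (univ N)"
      using ji by (auto simp: N_def inj_on_def)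
    fix R ys assume R: "R \<in> \<tau>" and "ys \<in> tuples_over (ar R) (univ N)"
    then have "set ys \<subseteq> i ` univ B" by (simp add: tuples_over_def N_def)
    then have "map i (map j ys) = ys" "set (map j ys) \<subseteq> univ B"
      using ji by (induction ys) auto
    then obtain xs where ys: "ys = map i xs" "set xs \<subseteq> univ B"
      by metis
    \<comment> \<open>Injectivity of \<open>i\<close> on tuples: membership of
      \<open>map i xs\<close> in the image relation must come from \<open>xs\<close> itself.\<close>
    have "xs = zs" if "map i xs = map i zs" "zs \<in> interp B R" for zs
    proof -
      have "set zs \<subseteq> univ B"
        using B(1) R that(2) by (auto simp: is_struct_def tuples_over_def)
      from tuple[OF this] tuple[OF ys(2)] that(1) show ?thesis by simp
    qed
    then show "ys \<in> interp N R \<longleftrightarrow> map j ys \<in> interp B R"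
      using tuple[OF ys(2)] by (auto simp: N_def ys(1))
  qed
  then have "\<not> models_ucq N \<mu>"
    using embeds[OF N] unfolding embeds_def by blast
  moreover have "is_hom \<tau> i B N"
    by (auto simp: is_hom_def N_def)
  ultimately have "\<not> models_ucq B \<mu>"
    using models_ucq_hom[OF ucq] by blast
  \<comment> \<open>Structures without \<open>\<mu>\<close> embed and so map homomorphically;
    conversely, a homomorphism would carry \<open>\<mu>\<close> from \<open>A\<close> to
    \<open>B\<close>, where it fails.\<close>
  then have "(\<exists>h. is_hom \<tau> h A B) \<longleftrightarrow> \<not> models_ucq A \<mu>" if "is_struct \<tau> ar A" for A :: "('r, nat) struct"
    using embeds[OF that] embedding_is_hom[OF _ that] models_ucq_hom[OF ucq]
    unfolding embeds_def by blast
  with B show ?thesis unfolding is_dual_def by blast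
qed

theorem proposition8p20:
  fixes \<tau> \<sigma> :: "nat set" and ar :: "nat \<Rightarrow> nat" and \<mu> :: "nat cq list"
  assumes "finite \<tau>"
    and "\<sigma> \<subseteq> \<tau>"
    and "is_ucq \<tau> ar \<mu>"
    and "\<And>q. q \<in> set \<mu> \<Longrightarrow> connected_cq \<tau> ar q"
  shows "(\<forall>B :: (nat, 'b) struct. is_dual \<tau> ar \<mu> B \<longrightarrow>
            polytime_equivalent (resilience_problem \<tau> ar \<sigma> \<mu>) (VCSP \<tau> ar (Gamma B \<sigma>))) \<and>
         (\<forall>B\<^sub>\<mu> :: (nat, 'c) struct. is_CSS_structure \<tau> ar \<mu> B\<^sub>\<mu> \<longrightarrow>
            polytime_equivalent (resilience_problem \<tau> ar \<sigma> \<mu>) (VCSP \<tau> ar (Gamma B\<^sub>\<mu> \<sigma>)))"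
proof (intro conjI allI impI)
  fix B :: "(nat, 'b) struct"
  assume "is_dual \<tau> ar \<mu> B"
  then show "polytime_equivalent (resilience_problem \<tau> ar \<sigma> \<mu>) (VCSP \<tau> ar (Gamma B \<sigma>))"
    by (rule resilience_equivalent_VCSP[OF assms(1,3)])
next
  fix B :: "(nat, 'c) struct"
  assume "is_CSS_structure \<tau> ar \<mu> B"
  then show "polytime_equivalent (resilience_problem \<tau> ar \<sigma> \<mu>) (VCSP \<tau> ar (Gamma B \<sigma>))"
    by (rule resilience_equivalent_VCSP[OF assms(1,3) is_CSS_structure_imp_dual[OF assms(3)]])
qed

end
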